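(* Let $f\in\mathcal{C}^3(\mathbb{R})$ with $f(1)=0$ and $f'(1)<0$, put $F(\rho)=\int_\rho^1 f(r)\,dr$ and $c_s=\sqrt{-2f'(1)}$, and suppose that: (1) $\frac{c_s^2}{4}(1-\rho)^2\le F(\rho)$ for all $\rho\ge 0$; (2) there exist $M\ge 0$ and $q\in[2,+\infty)$ such that $F(\rho)\le M|1-\rho|^q$ for all $\rho\ge 2$; (3) $f''(1)+3f'(1)\ne 0$. Then there exists $\mathfrak{q}_*\ge\frac1{32}$ such that for every $\mathfrak{p}$ satisfying either $\mathfrak{p}\in(0,\mathfrak{q}_* )$, or $\mathfrak{p}=\mathfrak{q}_*\notin\frac{\pi}{2}+\pi\mathbb{Z}$, there exists a travelling wave $\mathfrak{v}_c$ of speed $c\in(0,c_s)$ and of momentum $p(\mathfrak{v}_c)=\mathfrak{p}$.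
   Context: Functions on $\mathbb{R}$ are complex-valued. $\mathcal{X}^1(\mathbb{R})=\{u\in H^1_{loc}(\mathbb{R}) : u'\in L^2(\mathbb{R}),\ F(|u|^2)\in L^1(\mathbb{R})\}$ and $\mathcal{NX}^1(\mathbb{R})=\{u\in\mathcal{X}^1(\mathbb{R}) : \inf_{\mathbb{R}}|u|>0\}$. For $u\in\mathcal{NX}^1(\mathbb{R})$ written as $u=\rho e^{i\varphi}$ with $\rho=|u|$ and $\varphi$ real-valued, the momentum is $p(u)=\frac12\int_{\mathbb{R}}(1-\rho^2)\varphi'$. A travelling wave of speed $c$ is a non-constant solution $u=\mathfrak{v}_c$ of $icu'+u''+uf(|u|^2)=0$ on $\mathbb{R}$ (so that $\Psi(t,x)=u(x+ct)$ solves $i\partial_t\Psi+\partial_{xx}\Psi+\Psi f(|\Psi|^2)=0$); here it belongs to $\mathcal{NX}^1(\mathbb{R})$, so that its momentum is defined. *)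

theory Defs
  imports "HOL-Analysis.Analysis"
begin

definition C_k :: "nat \<Rightarrow> (real \<Rightarrow> real) \<Rightarrow> bool" where
  "C_k k f \<longleftrightarrow> (\<forall>j<k. \<forall>x. (deriv ^^ j) f differentiable at x) \<and> continuous_on UNIV ((deriv ^^ k) f)"

definition L2 :: "(real \<Rightarrow> 'a::euclidean_space) set" where
  "L2 = {v \<in> borel_measurable borel. integrable lborel (\<lambda>x. (norm (v x))\<^sup>2)}"

definition L2_loc :: "(real \<Rightarrow> 'a::euclidean_space) set" where
  "L2_loc = {v \<in> borel_measurable borel. \<forall>a b. set_integrable lborel {a..b} (\<lambda>x. (norm (v x))\<^sup>2)}"

text \<open>Weak derivatives on the line are tested against compactly supported C^1 functions,
  which is equivalent to testing against smooth ones.\<close>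

definition has_weak_deriv :: "(real \<Rightarrow> 'a::euclidean_space) \<Rightarrow> (real \<Rightarrow> 'a) \<Rightarrow> bool" where
  "has_weak_deriv u v \<longleftrightarrow>
     (\<forall>\<psi> \<psi>' :: real \<Rightarrow> real. \<forall>R.
        (\<forall>x. (\<psi> has_real_derivative \<psi>' x) (at x)) \<and> continuous_on UNIV \<psi>' \<and>
        (\<forall>x. \<bar>x\<bar> > R \<longrightarrow> \<psi> x = 0) \<longrightarrow>
        (LINT x|lborel. \<psi>' x *\<^sub>R u x) = - (LINT x|lborel. \<psi> x *\<^sub>R v x))"

text \<open>An element of the Sobolev space is represented by its continuous representative, so that
  pointwise notions such as the infimum of the modulus make sense.\<close>

definition H1_loc :: "(real \<Rightarrow> 'a::euclidean_space) set" where
  "H1_loc = {u. continuous_on UNIV u \<and> (\<exists>v \<in> L2_loc. has_weak_deriv u v)}"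

text \<open>The interval integral is oriented: for \<^term>\<open>\<rho> > 1\<close> it is minus the integral over
  \<^term>\<open>{1..\<rho>}\<close>.\<close>

definition potential :: "(real \<Rightarrow> real) \<Rightarrow> real \<Rightarrow> real" where
  "potential f \<rho> = (LBINT r=\<rho>..1. f r)"

definition X1 :: "(real \<Rightarrow> real) \<Rightarrow> (real \<Rightarrow> complex) set" where
  "X1 f = {u \<in> H1_loc. (\<exists>v \<in> L2. has_weak_deriv u v) \<and>
                       integrable lborel (\<lambda>x. potential f ((cmod (u x))\<^sup>2))}"

definition NX1 :: "(real \<Rightarrow> real) \<Rightarrow> (real \<Rightarrow> complex) set" where
  "NX1 f = {u \<in> X1 f. (INF x. cmod (u x)) > 0}"

text \<open>The momentum is stated as a relation, so that the convergence of its integral is part of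
  it. It is single-valued on non-vanishing functions, see \<open>has_momentum_unique\<close> below: the choice of the
  phase and of its weak derivative does not matter.\<close>

definition has_momentum :: "(real \<Rightarrow> complex) \<Rightarrow> real \<Rightarrow> bool" where
  "has_momentum u p \<longleftrightarrow>
     (\<exists>\<phi> \<phi>'. \<phi> \<in> H1_loc \<and> \<phi>' \<in> L2_loc \<and> has_weak_deriv \<phi> \<phi>' \<and>
        (\<forall>x. u x = of_real (cmod (u x)) * exp (\<i> * of_real (\<phi> x))) \<and>
        integrable lborel (\<lambda>x. (1 - (cmod (u x))\<^sup>2) * \<phi>' x) \<and>
        p = 1 / 2 * (LINT x|lborel. (1 - (cmod (u x))\<^sup>2) * \<phi>' x))"

text \<open>The equation is understood classically; as the coefficients are continuous, a continuous
  weak solution is automatically twice continuously differentiable.\<close>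

definition travelling_wave :: "(real \<Rightarrow> real) \<Rightarrow> real \<Rightarrow> (real \<Rightarrow> complex) \<Rightarrow> bool" where
  "travelling_wave f c u \<longleftrightarrow> u \<in> NX1 f \<and> \<not> u constant_on UNIV \<and>
     (\<exists>u' u''. \<forall>x. (u has_vector_derivative u' x) (at x) \<and>
                   (u' has_vector_derivative u'' x) (at x) \<and>
                   \<i> * of_real c * u' x + u'' x + u x * of_real (f ((cmod (u x))\<^sup>2)) = 0)"

lemma L2_loc_integrable:
  fixes v :: "real \<Rightarrow> real"
  assumes "v \<in> L2_loc"
  shows "set_integrable lborel {a..b} v"
proof -
  have m: "v \<in> borel_measurable borel" and i: "set_integrable lborel {a..b} (\<lambda>x. (v x)\<^sup>2)"
    using assms by (auto simp: L2_loc_def)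
  have j: "set_integrable lborel {a..b} (\<lambda>x. 1 + (v x)\<^sup>2)"
  proof (rule set_integral_add(1)[OF _ i])
    show "set_integrable lborel {a..b} (\<lambda>x. 1 :: real)"
      by (rule borel_integrable_atLeastAtMost') (rule continuous_on_const)
  qed
  have k: "\<bar>t\<bar> \<le> 1 + t\<^sup>2" for t :: real
  proof -
    have "0 \<le> (\<bar>t\<bar> - 1)\<^sup>2" by simp
    also have "(\<bar>t\<bar> - 1)\<^sup>2 = t\<^sup>2 - 2 * \<bar>t\<bar> + 1" by (simp add: power2_diff)
    finally show ?thesis by (smt (verit) zero_le_power2)
  qed
  show ?thesis
    unfolding set_integrable_def
  proof (rule Bochner_Integration.integrable_bound[OF j[unfolded set_integrable_def]])
    show "(\<lambda>x. indicator {a..b} x *\<^sub>R v x) \<in> borel_measurable lborel" using m by measurable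
    show "AE x in lborel. norm (indicator {a..b} x *\<^sub>R v x) \<le> norm (indicator {a..b} x *\<^sub>R (1 + (v x)\<^sup>2))"
      using k by (auto simp: indicator_def)
  qed
qed

lemma sq_max_deriv:
  "((\<lambda>x. (max 0 (x - a))\<^sup>2) has_real_derivative 2 * max 0 (x - a)) (at (x::real))"
proof (cases "x = a")
  case False
  then consider "x > a" | "x < a" by linarith
  then show ?thesis
  proof cases
    case 1
    have e: "((\<lambda>x. (x - a)\<^sup>2) has_real_derivative 2 * max 0 (x - a)) (at x)"
      using 1 by (auto intro!: derivative_eq_intros)
    show ?thesis
      by (rule has_field_derivative_transform_within_open[OF e, of "{a<..}"])
         (use 1 in auto)
  next
    case 2
    have e: "((\<lambda>x. 0) has_real_derivative 2 * max 0 (x - a)) (at x)"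
      using 2 by (auto intro!: derivative_eq_intros)
    show ?thesis
      by (rule has_field_derivative_transform_within_open[OF e, of "{..<a}"]) (use 2 in auto)
  qed
next
  case True
  have "((\<lambda>h. (max 0 (a + h - a))\<^sup>2 / h) \<longlongrightarrow> 0) (at 0)"
  proof (rule Lim_null_comparison[where g = "\<lambda>h. \<bar>h\<bar>"])
    show "\<forall>\<^sub>F h in at 0. norm ((max 0 (a + h - a))\<^sup>2 / h) \<le> \<bar>h\<bar>"
      by (auto simp: max_def power2_eq_square)
    show "((\<lambda>h. \<bar>h\<bar>) \<longlongrightarrow> (0::real)) (at 0)"
      by (auto intro!: tendsto_eq_intros)
  qed
  then show ?thesis using True by (simp add: DERIV_def)
qed

lemma sq_max_deriv':
  "((\<lambda>x. (max 0 (b - x))\<^sup>2) has_real_derivative - 2 * max 0 (b - x)) (at (x::real))"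
proof -
  have "((\<lambda>x. (max 0 (- x - (- b)))\<^sup>2) has_real_derivative (2 * max 0 (- x - (- b))) * (- 1)) (at x)"
    by (rule DERIV_chain2[of "\<lambda>y. (max 0 (y - (- b)))\<^sup>2" _ "\<lambda>x. - x" x "- 1" UNIV])
       (rule sq_max_deriv, auto intro!: derivative_eq_intros)
  then show ?thesis by (simp add: algebra_simps)
qed

lemma fundamental_interval:
  fixes w :: "real \<Rightarrow> real"
  assumes w: "w \<in> L2_loc"
    and z: "\<And>\<psi> \<psi>' R. (\<forall>x. (\<psi> has_real_derivative \<psi>' x) (at x)) \<Longrightarrow> continuous_on UNIV \<psi>' \<Longrightarrow>
        (\<forall>x. \<bar>x\<bar> > R \<longrightarrow> \<psi> x = 0) \<Longrightarrow> (LINT x|lborel. \<psi> x * w x) = 0"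
  shows "(LINT x|lborel. indicator {a<..<b} x * w x) = 0"
proof -
  define m where "m x = (max 0 (x - a))\<^sup>2 * (max 0 (b - x))\<^sup>2" for x
  define m' where "m' x = 2 * max 0 (x - a) * (max 0 (b - x))\<^sup>2 + (max 0 (x - a))\<^sup>2 * (- 2 * max 0 (b - x))" for x
  have dm: "(m has_real_derivative m' x) (at x)" for x
    unfolding m_def m'_def
    using DERIV_mult[OF sq_max_deriv[of a x] sq_max_deriv'[of b x]]
    by (simp add: algebra_simps)
  have m0: "m x \<ge> 0" for x by (simp add: m_def)
  define \<psi> where "\<psi> n x = 1 - 1 / (1 + real n * m x)" for n x
  have pos: "1 + real n * m x > 0" for n x using m0[of x] by (smt (verit) mult_nonneg_nonneg of_nat_0_le_iff)
  have d: "(\<psi> n has_real_derivative real n * m' x / (1 + real n * m x)\<^sup>2) (at x)" for n x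
    unfolding \<psi>_def
    by (rule derivative_eq_intros dm refl | use pos[of n x] in \<open>simp add: power2_eq_square field_simps\<close>)+
  have cm: "continuous_on UNIV m" unfolding m_def by (intro continuous_intros)
  have cm': "continuous_on UNIV m'" unfolding m'_def by (intro continuous_intros)
  have c: "continuous_on UNIV (\<lambda>x. real n * m' x / (1 + real n * m x)\<^sup>2)" for n
    using pos[of n] by (intro continuous_intros cm cm') (metis less_irrefl power_not_zero)
  have out: "\<psi> n x = 0" if "x \<notin> {a<..<b}" for n x
    using that by (auto simp: \<psi>_def m_def)
  have bd: "0 \<le> \<psi> n x" "\<psi> n x \<le> 1" for n x
    using m0[of x] pos[of n x] by (auto simp: \<psi>_def)
  have zero: "(LINT x|lborel. \<psi> n x * w x) = 0" for n
  proof (rule z)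
    show "\<forall>x. (\<psi> n has_real_derivative real n * m' x / (1 + real n * m x)\<^sup>2) (at x)" using d by blast
    show "\<forall>x. \<bar>x\<bar> > \<bar>a\<bar> + \<bar>b\<bar> \<longrightarrow> \<psi> n x = 0" by (intro allI impI out) auto
  qed (rule c)
  have wm[measurable]: "w \<in> borel_measurable borel" using w by (auto simp: L2_loc_def)
  have pm[measurable]: "\<psi> n \<in> borel_measurable borel" for n
    by (rule borel_measurable_continuous_onI, unfold \<psi>_def)
       (use pos[of n] in \<open>intro continuous_intros cm, auto simp: less_le\<close>)
  have "(\<lambda>n. LINT x|lborel. \<psi> n x * w x) \<longlonglongrightarrow> (LINT x|lborel. indicator {a<..<b} x * w x)"
  proof (rule integral_dominated_convergence[where w = "\<lambda>x. \<bar>indicator {a..b} x *\<^sub>R w x\<bar>"])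
    show "integrable lborel (\<lambda>x. \<bar>indicator {a..b} x *\<^sub>R w x\<bar>)"
      using L2_loc_integrable[OF w, of a b] unfolding set_integrable_def by (rule integrable_abs)
    show "AE x in lborel. (\<lambda>n. \<psi> n x * w x) \<longlonglongrightarrow> indicator {a<..<b} x * w x"
    proof (rule AE_I2)
      fix x
      have "(\<lambda>n. \<psi> n x) \<longlonglongrightarrow> indicator {a<..<b} x"
      proof (cases "x \<in> {a<..<b}")
        case True
        then have "m x > 0" by (auto simp: m_def)
        then have "filterlim (\<lambda>n. 1 + real n * m x) at_top sequentially"
          by (intro filterlim_tendsto_add_at_top[OF tendsto_const]
              filterlim_at_top_mult_tendsto_pos[OF tendsto_const] filterlim_real_sequentially)
        then have "(\<lambda>n. 1 / (1 + real n * m x)) \<longlonglongrightarrow> 0"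
          by (rule real_tendsto_divide_at_top[OF tendsto_const])
        then have "(\<lambda>n. 1 - 1 / (1 + real n * m x)) \<longlonglongrightarrow> 1 - 0"
          by (intro tendsto_diff tendsto_const)
        then show ?thesis using True by (simp add: \<psi>_def)
      next
        case False
        then show ?thesis using out by simp
      qed
      then show "(\<lambda>n. \<psi> n x * w x) \<longlonglongrightarrow> indicator {a<..<b} x * w x"
        by (intro tendsto_mult tendsto_const)
    qed
    show "AE x in lborel. norm (\<psi> n x * w x) \<le> \<bar>indicator {a..b} x *\<^sub>R w x\<bar>" for n
    proof (rule AE_I2)
      fix x
      show "norm (\<psi> n x * w x) \<le> \<bar>indicator {a..b} x *\<^sub>R w x\<bar>"
        using bd[of n x] out[of x n]
        by (cases "x \<in> {a<..<b}") (auto simp: abs_mult mult_left_le_one_le)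
    qed
  qed measurable
  then show ?thesis using zero by (simp add: LIMSEQ_const_iff)
qed

lemma fundamental_AE:
  fixes w :: "real \<Rightarrow> real"
  assumes w: "w \<in> L2_loc"
    and z: "\<And>a b. (LINT x|lborel. indicator {a<..<b} x * w x) = 0"
  shows "AE x in lborel. w x = 0"
proof -
  have wm[measurable]: "w \<in> borel_measurable borel" using w by (auto simp: L2_loc_def)
  have loc: "AE x in lborel. x \<in> {-r<..<r} \<longrightarrow> w x = 0" for r
  proof -
    let ?I = "{-r<..<r}"
    have int: "integrable lborel (\<lambda>x. indicator ?I x * w x)"
    proof -
      have "set_integrable lborel ?I w"
        by (rule set_integrable_subset[OF L2_loc_integrable[OF w, of "-r" r]]) auto
      then show ?thesis by (simp add: set_integrable_def)
    qed
    have intA: "integrable lborel (\<lambda>x. indicator A x * (indicator ?I x * w x))" if "A \<in> sets borel" for A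
      using integrable_mult_indicator[OF _ int, of A] that by simp
    let ?G = "range (\<lambda>(a, b). {a<..<b::real})"
    have sb: "sigma_sets UNIV ?G = sets borel"
    proof -
      have "(borel :: real measure) = sigma UNIV ?G"
        using borel_eq_box[where 'a = real] by (simp add: box_real)
      then have "sets (borel :: real measure) = sets (sigma UNIV ?G)" by (rule arg_cong)
      then show ?thesis by (simp add: sets_measure_of_conv)
    qed
    have dyn: "(LINT x|lborel. indicator A x * (indicator ?I x * w x)) = 0" if A: "A \<in> sigma_sets UNIV ?G" for A
    proof -
      have st: "Int_stable ?G"
      proof (rule Int_stableI)
        fix A B assume "A \<in> ?G" "B \<in> ?G"
        then obtain a b c d where "A = {a<..<b}" "B = {c<..<d}" by auto
        then have "A \<inter> B = (\<lambda>(a, b). {a<..<b}) (max a c, min b d)" by auto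
        then show "A \<inter> B \<in> ?G" by blast
      qed
      have univ: "(LINT x|lborel. indicator ?I x * w x) = 0" by (rule z)
      show ?thesis
        using st subset_UNIV[of ?G, folded Pow_UNIV] A
      proof (induct rule: sigma_sets_induct_disjoint)
        case (basic A)
        then obtain a b where A: "A = {a<..<b}" by auto
        have "(\<lambda>x. indicator A x * (indicator ?I x * w x)) = (\<lambda>x. indicator {max a (-r)<..<min b r} x * w x)"
          by (rule ext) (auto simp: A indicator_def)
        then show ?case using z by metis
      next
        case empty
        then show ?case by simp
      next
        case (compl A)
        then have As: "A \<in> sets borel" using sb by simp
        have "(\<lambda>x. indicator (UNIV - A) x * (indicator ?I x * w x))
             = (\<lambda>x. indicator ?I x * w x - indicator A x * (indicator ?I x * w x))"
          by (rule ext) (auto simp: indicator_def)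
        then show ?case
          using compl(2) univ Bochner_Integration.integral_diff[OF int intA[OF As]] by (metis diff_zero)
      next
        case (union A)
        then have As: "A i \<in> sets lborel" for i using sb by auto
        have "(LINT x:(\<Union>i. A i)|lborel. indicator ?I x * w x)
               = (\<Sum>i. LINT x:(A i)|lborel. indicator ?I x * w x)"
          using As union(1) intA[of "\<Union>i. A i"]
          by (intro lebesgue_integral_countable_add) (auto simp: disjoint_family_on_def set_integrable_def)
        then show ?case using union(3) by (simp add: set_lebesgue_integral_def)
      qed
    qed
    have P: "{x. w x > 0} \<in> sets borel" "{x. w x < 0} \<in> sets borel" by measurable
    have "AE x in lborel. indicator {x. w x > 0} x * (indicator ?I x * w x) = 0"
      using integral_nonneg_eq_0_iff_AE[OF intA[OF P(1)]] dyn[of "{x. w x > 0}"] P sb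
      by (auto simp: indicator_def)
    moreover have "AE x in lborel. - (indicator {x. w x < 0} x * (indicator ?I x * w x)) = 0"
      using integral_nonneg_eq_0_iff_AE[OF integrable_minus[OF intA[OF P(2)]]] dyn[of "{x. w x < 0}"] P sb
      by (auto simp: indicator_def)
    ultimately show ?thesis
      by eventually_elim (auto simp: indicator_def split: if_splits)
  qed
  have "AE x in lborel. \<forall>n::nat. x \<in> {-real n<..<real n} \<longrightarrow> w x = 0"
    unfolding AE_all_countable using loc by blast
  then show ?thesis
  proof eventually_elim
    case (elim x)
    obtain n :: nat where "\<bar>x\<bar> < real n" using reals_Archimedean2 by blast
    then show ?case using elim by (auto simp: abs_less_iff)
  qed
qed

lemma has_momentum_unique:
  assumes p: "has_momentum u p" and q: "has_momentum u q" and nz: "\<And>x. u x \<noteq> 0"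
  shows "p = q"
proof -
  obtain \<phi> \<phi>' where 1: "\<phi> \<in> H1_loc" "\<phi>' \<in> L2_loc" "has_weak_deriv \<phi> \<phi>'"
      "\<And>x. u x = of_real (cmod (u x)) * exp (\<i> * of_real (\<phi> x))"
      "p = 1 / 2 * (LINT x|lborel. (1 - (cmod (u x))\<^sup>2) * \<phi>' x)"
      "integrable lborel (\<lambda>x. (1 - (cmod (u x))\<^sup>2) * \<phi>' x)"
    using p unfolding has_momentum_def by blast
  obtain \<theta> \<theta>' where 2: "\<theta> \<in> H1_loc" "\<theta>' \<in> L2_loc" "has_weak_deriv \<theta> \<theta>'"
      "\<And>x. u x = of_real (cmod (u x)) * exp (\<i> * of_real (\<theta> x))"
      "q = 1 / 2 * (LINT x|lborel. (1 - (cmod (u x))\<^sup>2) * \<theta>' x)"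
      "integrable lborel (\<lambda>x. (1 - (cmod (u x))\<^sup>2) * \<theta>' x)"
    using q unfolding has_momentum_def by blast
  have [measurable]: "\<phi>' \<in> borel_measurable borel" "\<theta>' \<in> borel_measurable borel"
    using 1 2 by (auto simp: L2_loc_def)
  have c: "continuous_on UNIV \<phi>" "continuous_on UNIV \<theta>" using 1 2 by (auto simp: H1_loc_def)
  have Z: "(\<phi> x - \<theta> x) / (2 * pi) \<in> \<int>" for x
  proof -
    have "exp (\<i> * of_real (\<phi> x)) = exp (\<i> * of_real (\<theta> x))"
      using 1(4)[of x] 2(4)[of x] nz[of x] by (metis mult_cancel_left mult_eq_0_iff)
    then obtain n :: int where "\<i> * of_real (\<phi> x) = \<i> * of_real (\<theta> x) + (of_int (2 * n) * pi) * \<i>"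
      unfolding exp_eq by blast
    then have "\<i> * of_real (\<phi> x) = \<i> * of_real (\<theta> x + of_int (2 * n) * pi)"
      by (simp add: algebra_simps)
    then have "\<phi> x = \<theta> x + of_int (2 * n) * pi"
      by (metis complex_i_not_zero mult_cancel_left of_real_eq_iff)
    then have "(\<phi> x - \<theta> x) / (2 * pi) = of_int n" by simp
    then show ?thesis by simp
  qed
  have "(\<lambda>x. (\<phi> x - \<theta> x) / (2 * pi)) constant_on UNIV"
  proof (rule continuous_discrete_range_constant)
    show "connected (UNIV :: real set)" by simp
    show "continuous_on UNIV (\<lambda>x. (\<phi> x - \<theta> x) / (2 * pi))"
      using c by (intro continuous_intros) auto
    fix x :: real
    show "\<exists>e>0. \<forall>y. y \<in> UNIV \<and> (\<phi> y - \<theta> y) / (2 * pi) \<noteq> (\<phi> x - \<theta> x) / (2 * pi) \<longrightarrow>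
        e \<le> norm ((\<phi> y - \<theta> y) / (2 * pi) - (\<phi> x - \<theta> x) / (2 * pi))"
      using Z by (intro exI[of _ 1]) (auto intro!: Ints_nonzero_abs_ge1 Ints_diff)
  qed
  then obtain k0 where k0: "\<And>x. (\<phi> x - \<theta> x) / (2 * pi) = k0" by (auto simp: constant_on_def)
  define k where "k = k0 * (2 * pi)"
  have k: "\<phi> x = \<theta> x + k" for x
    using k0[of x] pi_gt_zero unfolding k_def by (simp add: divide_eq_eq)
  define w where "w x = \<phi>' x - \<theta>' x" for x
  have sq: "(s - t)\<^sup>2 \<le> 2 * s\<^sup>2 + 2 * t\<^sup>2" for s t :: real
  proof -
    have "0 \<le> (s + t)\<^sup>2" by simp
    then show ?thesis by (simp add: power2_eq_square algebra_simps)
  qed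
  have w: "w \<in> L2_loc"
    unfolding L2_loc_def
  proof (safe)
    show "w \<in> borel_measurable borel" unfolding w_def by measurable
    fix a b :: real
    have "set_integrable lborel {a..b} (\<lambda>x. 2 * (\<phi>' x)\<^sup>2 + 2 * (\<theta>' x)\<^sup>2)"
      using 1(2) 2(2) by (intro set_integral_add set_integrable_mult_right) (auto simp: L2_loc_def)
    then show "set_integrable lborel {a..b} (\<lambda>x. (norm (w x))\<^sup>2)"
      unfolding set_integrable_def
      by (rule Bochner_Integration.integrable_bound) (auto simp: w_def indicator_def sq)
  qed
  have "(LINT x|lborel. indicator {a<..<b} x * w x) = 0" for a b
  proof (rule fundamental_interval[OF w])
    fix \<psi> \<psi>' :: "real \<Rightarrow> real" and R
    assume h: "\<forall>x. (\<psi> has_real_derivative \<psi>' x) (at x)" "continuous_on UNIV \<psi>'"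
      "\<forall>x. \<bar>x\<bar> > R \<longrightarrow> \<psi> x = 0"
    define S where "S = \<bar>R\<bar> + 1"
    have S: "\<psi> x = 0" "\<psi>' x = 0" if "x \<notin> {-S..S}" for x
    proof -
      have o: "\<bar>x\<bar> > R" using that by (auto simp: S_def)
      then show "\<psi> x = 0" using h by blast
      have "((\<lambda>x. 0) has_real_derivative \<psi>' x) (at x)"
        by (rule has_field_derivative_transform_within_open[of \<psi> _ _ "{x. \<bar>x\<bar> > R}"])
           (use h o in \<open>auto intro!: open_Collect_less continuous_intros\<close>)
      then show "\<psi>' x = 0" using DERIV_unique[OF _ DERIV_const] by blast
    qed
    have c\<psi>: "continuous_on UNIV \<psi>"
      using h(1) by (meson DERIV_continuous continuous_at_imp_continuous_on)
    have ci: "integrable lborel (\<lambda>x. \<psi>' x * g x)" if "continuous_on UNIV g" for g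
    proof -
      have "set_integrable lborel {-S..S} (\<lambda>x. \<psi>' x * g x)"
        by (rule borel_integrable_atLeastAtMost', rule continuous_on_subset[OF continuous_on_mult[OF h(2) that]]) simp
      moreover have "(\<lambda>x. indicator {-S..S} x *\<^sub>R (\<psi>' x * g x)) = (\<lambda>x. \<psi>' x * g x)"
      proof
        fix x
        show "indicator {-S..S} x *\<^sub>R (\<psi>' x * g x) = \<psi>' x * g x"
          using S[of x] by (cases "x \<in> {-S..S}") auto
      qed
      ultimately show ?thesis unfolding set_integrable_def by metis
    qed
    have vi: "integrable lborel (\<lambda>x. \<psi> x * v x)" if v: "v \<in> L2_loc" for v
    proof -
      obtain B where B: "\<And>x. x \<in> {-S..S} \<Longrightarrow> \<bar>\<psi> x\<bar> \<le> B"
        using compact_imp_bounded[OF compact_continuous_image[OF continuous_on_subset[OF c\<psi>] compact_Icc]]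
        by (metis bounded_real imageI subset_UNIV)
      have [measurable]: "\<psi> \<in> borel_measurable borel" "v \<in> borel_measurable borel"
        using c\<psi> v by (auto intro: borel_measurable_continuous_onI simp: L2_loc_def)
      have "integrable lborel (\<lambda>x. B * (indicator {-S..S} x *\<^sub>R v x))"
        using L2_loc_integrable[OF v, of "-S" S] unfolding set_integrable_def by (rule integrable_mult_right)
      then show ?thesis
      proof (rule Bochner_Integration.integrable_bound)
        show "AE x in lborel. norm (\<psi> x * v x) \<le> norm (B * (indicator {-S..S} x *\<^sub>R v x))"
        proof (rule AE_I2)
          fix x
          show "norm (\<psi> x * v x) \<le> norm (B * (indicator {-S..S} x *\<^sub>R v x))"
            using S[of x] B[of x]
            by (cases "x \<in> {-S..S}") (auto simp: abs_mult intro!: mult_right_mono)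
        qed
      qed measurable
    qed
    have "(LINT x|lborel. indicator {-S..S} x *\<^sub>R \<psi>' x) = \<psi> S - \<psi> (-S)"
      by (rule integral_FTC_atLeastAtMost)
         (use h in \<open>auto simp: S_def has_real_derivative_iff_has_vector_derivative
            intro: has_vector_derivative_at_within continuous_on_subset\<close>)
    moreover have "(\<lambda>x. indicator {-S..S} x *\<^sub>R \<psi>' x) = \<psi>'"
    proof
      fix x
      show "indicator {-S..S} x *\<^sub>R \<psi>' x = \<psi>' x"
        using S[of x] by (cases "x \<in> {-S..S}") auto
    qed
    moreover have "\<psi> S = 0" "\<psi> (-S) = 0" using h(3) by (auto simp: S_def)
    ultimately have z: "(LINT x|lborel. \<psi>' x) = 0" by simp
    have a: "(LINT x|lborel. \<psi>' x * \<phi> x) = - (LINT x|lborel. \<psi> x * \<phi>' x)"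
      "(LINT x|lborel. \<psi>' x * \<theta> x) = - (LINT x|lborel. \<psi> x * \<theta>' x)"
      using 1(3) 2(3) h unfolding has_weak_deriv_def real_scaleR_def by blast+
    have "(LINT x|lborel. \<psi>' x * \<phi> x) = (LINT x|lborel. \<psi>' x * \<theta> x + \<psi>' x * k)"
      by (simp add: k distrib_left)
    also have "\<dots> = (LINT x|lborel. \<psi>' x * \<theta> x) + (LINT x|lborel. \<psi>' x * k)"
      by (intro Bochner_Integration.integral_add ci c continuous_on_const)
    also have "(LINT x|lborel. \<psi>' x * k) = 0" using z by simp
    finally have "(LINT x|lborel. \<psi> x * \<phi>' x) - (LINT x|lborel. \<psi> x * \<theta>' x) = 0" using a by simp
    then show "(LINT x|lborel. \<psi> x * w x) = 0"
      by (simp add: w_def right_diff_distrib Bochner_Integration.integral_diff[OF vi[OF 1(2)] vi[OF 2(2)]])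
  qed
  then have "AE x in lborel. w x = 0" by (rule fundamental_AE[OF w])
  then have "AE x in lborel. (1 - (cmod (u x))\<^sup>2) * \<phi>' x = (1 - (cmod (u x))\<^sup>2) * \<theta>' x"
    by eventually_elim (simp add: w_def)
  then have "(LINT x|lborel. (1 - (cmod (u x))\<^sup>2) * \<phi>' x) = (LINT x|lborel. (1 - (cmod (u x))\<^sup>2) * \<theta>' x)"
    using 1(6) 2(6) by (intro integral_cong_AE) (auto dest: borel_measurable_integrable)
  then show ?thesis using 1(5) 2(5) by simp
qed

end

(* Writing r = |u|^2 and u = sqrt r exp(i phi), the equation of travelling waves integrates to
   phi' = c (1 - r) / (2 r) and r'^2 = (1 - r)^2 (G r - c^2), where G r = 4 r F(r) / (1 - r)^2.
   The function G is C^2, also at 1, and hypothesis (1) gives G r >= c_s^2 r with equality at 1,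
   so that G' 1 = c_s^2 > 0.  Whenever G' > 0 on [a, 1] there is a soliton with minimal density a and
   speed sqrt (G a) < c_s.  It is desingularised by r = a + (1 - a) T^2: then T solves a first order
   equation T' = (1 - T^2) E(T) with E > 0, and T = tanh y makes it regular on the whole line.
   Its momentum is an integral over T in [-1, 1], continuous in a and vanishing at a = 1, so by the
   intermediate value theorem it suffices to exceed 1/32 somewhere.  Either G' > 0 on [0, 1], and the
   momentum approaches that of the black soliton, pi/2, as a tends to 0; or the momentum diverges as a
   decreases to the largest zero of G'.  Hence q0 = 1/32 will do. *)
theory Submission
  imports Defs
begin

section \<open>Weighted means along a segment and the potential\<close>

text \<open>Parametrising the segment from \<open>b\<close> to \<open>s\<close> by
  \<open>\<theta>\<close> in [0, 1] keeps the domain of integration fixed, so that the dependence on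
  both endpoints stays regular even at \<open>s = b\<close>. Applied to derivatives, the weight 1
  gives divided differences and the weight \<open>1 - \<theta>\<close> gives Taylor
  remainders.\<close>

definition wmean :: "(real \<Rightarrow> real) \<Rightarrow> (real \<Rightarrow> real) \<Rightarrow> real \<Rightarrow> real \<Rightarrow> real" where
  "wmean w g b s = integral {0..1} (\<lambda>\<theta>. w \<theta> * g (b + \<theta> * (s - b)))"

lemma continuous_on_wmean:
  assumes w: "continuous_on UNIV w" and g: "continuous_on UNIV g"
  shows "continuous_on UNIV (\<lambda>(b, s). wmean w g b s)"
proof -
  have "continuous_on UNIV (\<lambda>p. integral (cbox 0 1) (\<lambda>\<theta>. w \<theta> * g (fst p + \<theta> * (snd p - fst p))))"
    by (rule integral_continuous_on_param)
       (auto simp: case_prod_unfold intro!: continuous_intros continuous_on_compose2[OF w] continuous_on_compose2[OF g])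
  then show ?thesis by (simp add: wmean_def case_prod_unfold)
qed

lemma continuous_on_wmean2:
  assumes "continuous_on UNIV w" "continuous_on UNIV g" "continuous_on A b" "continuous_on A s"
  shows "continuous_on A (\<lambda>x. wmean w g (b x) (s x))"
  using continuous_on_compose2[OF continuous_on_wmean[OF assms(1,2)] continuous_on_Pair[OF assms(3,4)]]
  by simp

lemma has_real_derivative_affine_comp:
  assumes "\<And>x. (g has_real_derivative g' x) (at (x::real))"
  shows "((\<lambda>\<theta>. g (b + \<theta> * k)) has_real_derivative g' (b + \<theta> * k) * k) (at \<theta> within S)"
    "((\<lambda>s. g (b + \<theta> * (s - d))) has_real_derivative g' (b + \<theta> * (s - d)) * \<theta>) (at s within S)"
  by (rule DERIV_chain2[OF assms], auto intro!: derivative_eq_intros)+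

text \<open>Differentiation under the integral sign brings down a factor \<open>\<theta>\<close>,
  which the weight absorbs. General weights thus allow the rule to be iterated.\<close>

lemma has_real_derivative_wmean:
  assumes w: "continuous_on UNIV w"
    and g: "\<And>x. (g has_real_derivative g' x) (at x)" and g': "continuous_on UNIV g'"
  shows "(wmean w g b has_real_derivative wmean (\<lambda>\<theta>. w \<theta> * \<theta>) g' b s) (at s)"
proof -
  have cg: "continuous_on UNIV g"
    using g by (meson DERIV_continuous continuous_at_imp_continuous_on)
  have "((\<lambda>s. integral (cbox 0 1) (\<lambda>\<theta>. w \<theta> * g (b + \<theta> * (s - b)))) has_field_derivative
     integral (cbox 0 1) (\<lambda>\<theta>. w \<theta> * \<theta> * g' (b + \<theta> * (s - b)))) (at s within UNIV)"
  proof (rule leibniz_rule_field_derivative)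
    show "((\<lambda>s. w \<theta> * g (b + \<theta> * (s - b))) has_field_derivative w \<theta> * \<theta> * g' (b + \<theta> * (s - b))) (at s within UNIV)" for s \<theta>
      using DERIV_cmult[OF has_real_derivative_affine_comp(2)[OF g], of "w \<theta>"] by (simp add: mult_ac)
    show "(\<lambda>\<theta>. w \<theta> * g (b + \<theta> * (s - b))) integrable_on cbox 0 1" for s
      by (intro integrable_continuous continuous_intros continuous_on_compose2[OF w] continuous_on_compose2[OF cg]) auto
    show "continuous_on (UNIV \<times> cbox 0 1) (\<lambda>(s, \<theta>). w \<theta> * \<theta> * g' (b + \<theta> * (s - b)))"
      by (auto simp: case_prod_unfold intro!: continuous_intros continuous_on_compose2[OF w] continuous_on_compose2[OF g'])
  qed auto
  then show ?thesis by (simp add: wmean_def[abs_def])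
qed

text \<open>The fundamental theorem of calculus along the segment. The divided difference is
  multiplied out, so that \<open>s = b\<close> is no exception.\<close>

lemma wmean_secant:
  assumes g: "\<And>x. (g has_real_derivative g' x) (at x)"
  shows "(s - b) * wmean (\<lambda>_. 1) g' b s = g s - g b"
proof -
  have "((\<lambda>\<theta>. (s - b) * g' (b + \<theta> * (s - b))) has_integral
      g (b + 1 * (s - b)) - g (b + 0 * (s - b))) {0..1}"
  proof (rule fundamental_theorem_of_calculus)
    fix x :: real
    have "((\<lambda>\<theta>. g (b + \<theta> * (s - b))) has_real_derivative (s - b) * g' (b + x * (s - b))) (at x within {0..1})"
      by (subst mult.commute) (rule has_real_derivative_affine_comp(1)[OF g])
    then show "((\<lambda>\<theta>. g (b + \<theta> * (s - b))) has_vector_derivative (s - b) * g' (b + x * (s - b))) (at x within {0..1})"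
      by (simp add: has_real_derivative_iff_has_vector_derivative)
  qed simp
  then have "integral {0..1} (\<lambda>\<theta>. (s - b) * g' (b + \<theta> * (s - b))) = g s - g b"
    by (subst integral_unique) simp_all
  then show ?thesis by (simp add: wmean_def)
qed

lemma wmean_one_self [simp]: "wmean (\<lambda>_. 1) g b b = g b"
  by (simp add: wmean_def)

lemma wmean_one_bounds:
  assumes g: "continuous_on UNIV g" and b: "\<And>x. b \<le> x \<Longrightarrow> x \<le> s \<Longrightarrow> m \<le> g x \<and> g x \<le> M" and "b \<le> s"
  shows "m \<le> wmean (\<lambda>_. 1) g b s" "wmean (\<lambda>_. 1) g b s \<le> M"
proof -
  have i: "(\<lambda>\<theta>. 1 * g (b + \<theta> * (s - b))) integrable_on {0..1}"
    by (intro integrable_continuous_interval continuous_intros continuous_on_compose2[OF g]) auto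
  have r: "m \<le> 1 * g (b + \<theta> * (s - b)) \<and> 1 * g (b + \<theta> * (s - b)) \<le> M" if "\<theta> \<in> {0..1}" for \<theta>
  proof -
    have "\<theta> * (s - b) \<le> 1 * (s - b)" using that \<open>b \<le> s\<close> by (intro mult_right_mono) auto
    then show ?thesis using b[of "b + \<theta> * (s - b)"] that \<open>b \<le> s\<close> by simp
  qed
  have "integral {0..1} (\<lambda>_::real. m) \<le> integral {0..1} (\<lambda>\<theta>. 1 * g (b + \<theta> * (s - b)))"
    by (rule integral_le[OF _ i]) (use r in auto)
  then show "m \<le> wmean (\<lambda>_. 1) g b s" by (simp add: wmean_def)
  have "integral {0..1} (\<lambda>\<theta>. 1 * g (b + \<theta> * (s - b))) \<le> integral {0..1} (\<lambda>_::real. M)"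
    by (rule integral_le[OF i]) (use r in auto)
  then show "wmean (\<lambda>_. 1) g b s \<le> M" by (simp add: wmean_def)
qed

text \<open>The minimum over the compact segment is attained, hence positive, and the mean lies
  above it.\<close>

lemma wmean_one_pos:
  assumes g: "continuous_on UNIV g" and b: "\<And>x. b \<le> x \<Longrightarrow> x \<le> s \<Longrightarrow> g x > 0" and "b \<le> s"
  shows "wmean (\<lambda>_. 1) g b s > 0"
proof -
  have c: "continuous_on {b..s} g" and ne: "{b..s} \<noteq> {}"
    using continuous_on_subset[OF g] \<open>b \<le> s\<close> by auto
  obtain z where z: "z \<in> {b..s}" "\<forall>x\<in>{b..s}. g z \<le> g x"
    using continuous_attains_inf[OF compact_Icc ne c] by blast
  obtain y where y: "y \<in> {b..s}" "\<forall>x\<in>{b..s}. g x \<le> g y"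
    using continuous_attains_sup[OF compact_Icc ne c] by blast
  have "g z \<le> wmean (\<lambda>_. 1) g b s"
    by (rule wmean_one_bounds(1)[OF g, where M = "g y"]) (use z y \<open>b \<le> s\<close> in auto)
  then show ?thesis using b[of z] z(1) by simp
qed

section \<open>Oriented primitives and the potential\<close>

lemma interval_integral_has_real_derivative:
  fixes g :: "real \<Rightarrow> real"
  assumes g: "continuous_on UNIV g"
  shows "((\<lambda>u. LBINT t=ereal b..ereal u. g t) has_real_derivative g x) (at x)"
proof -
  \<comment> \<open>The margin of 1 on both sides puts \<open>x\<close> in the interior of the
    interval, which turns the derivative within it into a full derivative.\<close>
  have "((\<lambda>u. LBINT t=ereal b..ereal u. g t) has_vector_derivative g x) (at x within {min x b - 1..max x b + 1})"
    by (rule interval_integral_FTC2) (auto intro: continuous_on_subset[OF g])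
  then show ?thesis
    by (subst (asm) at_within_interior) (auto simp: has_real_derivative_iff_has_vector_derivative)
qed

lemma potential_has_real_derivative:
  assumes f: "continuous_on UNIV f"
  shows "(potential f has_real_derivative - f x) (at x)"
proof -
  have "(\<lambda>u. - (LBINT y=ereal 1..ereal u. f y)) = potential f"
    unfolding potential_def by (rule ext) (subst (2) interval_integral_endpoints_reverse, simp add: one_ereal_def)
  then show ?thesis
    using DERIV_minus[OF interval_integral_has_real_derivative[OF f, of 1]] by simp
qed

lemma potential_at_1 [simp]: "potential f 1 = 0"
  by (simp add: potential_def one_ereal_def)

text \<open>Taylor's formula at 1 with integral remainder. The constant and linear terms vanish,
  because the potential is 0 at 1 and its derivative there is \<open>- f 1 = 0\<close>.\<close>

lemma potential_Taylor:
  assumes f: "\<And>x. (f has_real_derivative f' x) (at x)" and f': "continuous_on UNIV f'" and "f 1 = 0"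
  shows "potential f r = (1 - r)\<^sup>2 * wmean (\<lambda>\<theta>. 1 - \<theta>) (\<lambda>x. - f' x) 1 r"
proof -
  have cf: "continuous_on UNIV f"
    using f by (meson DERIV_continuous continuous_at_imp_continuous_on)
  note F = potential_has_real_derivative[OF cf]
  \<comment> \<open>The integration by parts packed into a single primitive: \<open>A 1\<close> is
    the potential at \<open>r\<close>, and \<open>A 0\<close> is 0 since \<open>f\<close> and the
    potential vanish at 1.\<close>
  define A where "A \<theta> = (1 - \<theta>) * (1 - r) * f (1 + \<theta> * (r - 1)) + potential f (1 + \<theta> * (r - 1))" for \<theta>
  have "((\<lambda>\<theta>. (1 - r)\<^sup>2 * ((1 - \<theta>) * - f' (1 + \<theta> * (r - 1)))) has_integral A 1 - A 0) {0..1}"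
  proof (rule fundamental_theorem_of_calculus)
    fix x :: real
    have "(A has_real_derivative ((0 - 1) * (1 - r)) * f (1 + x * (r - 1))
        + (f' (1 + x * (r - 1)) * (r - 1)) * ((1 - x) * (1 - r)) + - f (1 + x * (r - 1)) * (r - 1)) (at x within {0..1})"
      unfolding A_def
      by (intro DERIV_add DERIV_mult DERIV_cmult_right DERIV_diff DERIV_const DERIV_ident
          has_real_derivative_affine_comp(1) f F)
    then have "(A has_real_derivative (1 - r)\<^sup>2 * ((1 - x) * - f' (1 + x * (r - 1)))) (at x within {0..1})"
      by (rule DERIV_cong) (simp add: power2_eq_square algebra_simps)
    then show "(A has_vector_derivative (1 - r)\<^sup>2 * ((1 - x) * - f' (1 + x * (r - 1)))) (at x within {0..1})"
      by (simp add: has_real_derivative_iff_has_vector_derivative)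
  qed simp
  then have "integral {0..1} (\<lambda>\<theta>. (1 - r)\<^sup>2 * ((1 - \<theta>) * - f' (1 + \<theta> * (r - 1)))) = A 1 - A 0"
    by (rule integral_unique)
  moreover have "A 1 - A 0 = potential f r" using \<open>f 1 = 0\<close> by (simp add: A_def)
  ultimately show ?thesis unfolding wmean_def by (simp only: integral_mult_right)
qed

section \<open>First order equations and integrals on the line\<close>

text \<open>Separation of variables: \<open>X z\<close> is the time at which \<open>z\<close> is
  reached, and \<open>y\<close> is the inverse of \<open>X\<close>. The upper bound \<open>M\<close>
  makes these times exhaust the line, so that \<open>y\<close> is global; the lower bound
  \<open>m\<close> drives \<open>y\<close> to infinity at both ends.\<close>

lemma autonomous_solution:
  fixes v :: "real \<Rightarrow> real"
  assumes cv: "continuous_on UNIV v" and m: "0 < m" "\<And>z. m \<le> v z" and M: "\<And>z. v z \<le> M"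
  obtains y where "y 0 = 0" "\<And>x. (y has_real_derivative v (y x)) (at x)"
    "filterlim y at_top at_top" "filterlim y at_bot at_bot"
proof -
  have pos: "v z > 0" for z using m(1) m(2)[of z] by linarith
  have Mpos: "M > 0" using pos[of 0] M[of 0] by linarith
  have ci: "continuous_on S (\<lambda>z. 1 / v z)" for S
    using pos by (intro continuous_intros continuous_on_subset[OF cv]) (auto simp: less_le)
  define X where "X z = (LBINT t=ereal 0..ereal z. 1 / v t)" for z
  have dX: "(X has_real_derivative 1 / v z) (at z)" for z
    unfolding X_def[abs_def] by (rule interval_integral_has_real_derivative) (rule ci)
  have cX: "continuous_on S X" for S
    using dX by (meson DERIV_continuous continuous_at_imp_continuous_on)
  have X0: "X 0 = 0" by (simp add: X_def)
  have incr: "X b - X a \<ge> (b - a) / M" if "a \<le> b" for a b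
  proof (cases "a = b")
    case False
    then have "a < b" using that by simp
    then obtain z where "X b - X a = (b - a) * (1 / v z)" using MVT2[of a b X "\<lambda>z. 1 / v z"] dX by auto
    moreover have "1 / M \<le> 1 / v z" using M pos by (intro divide_left_mono) (auto simp: Mpos)
    ultimately show ?thesis using that mult_left_mono[of "1 / M" "1 / v z" "b - a"] by simp
  qed simp
  have sm: "strict_mono X"
  proof (rule strict_monoI)
    fix a b :: real assume "a < b"
    then have "0 < (b - a) / M" using Mpos by simp
    then show "X a < X b" using incr[of a b] \<open>a < b\<close> by linarith
  qed
  have surj: "\<exists>z. X z = x" for x
  proof -
    have "X (- M * \<bar>x\<bar>) \<le> x" using incr[of "- M * \<bar>x\<bar>" 0] X0 Mpos by auto
    moreover have "x \<le> X (M * \<bar>x\<bar>)" using incr[of 0 "M * \<bar>x\<bar>"] X0 Mpos by auto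
    moreover have "- M * \<bar>x\<bar> \<le> M * \<bar>x\<bar>" using Mpos mult_nonneg_nonneg[of M "\<bar>x\<bar>"] by linarith
    ultimately show ?thesis using IVT'[of X "- M * \<bar>x\<bar>" x "M * \<bar>x\<bar>"] cX by blast
  qed
  define y where "y = inv X"
  have inj: "inj X" using sm by (rule strict_mono_imp_inj_on)
  have Xy: "X (y x) = x" for x unfolding y_def using surj by (metis f_inv_into_f rangeI)
  have yX: "y (X z) = z" for z unfolding y_def using inj by simp
  have dy: "(y has_real_derivative v (y x)) (at x)" for x
  proof -
    have "(y has_derivative (*) (v (y x))) (at (X (y x)))"
    proof (rule has_derivative_inverse_strong[where f = X and f' = "(*) (1 / v (y x))" and S = UNIV])
      show "(X has_derivative (*) (1 / v (y x))) (at (y x))" using dX by (simp add: has_field_derivative_def)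
      show "(*) (1 / v (y x)) \<circ> (*) (v (y x)) = id" using pos[of "y x"] by (auto simp: fun_eq_iff)
    qed (auto simp: yX cX)
    then show ?thesis by (simp add: Xy has_field_derivative_def)
  qed
  have y0: "y 0 = 0" using yX[of 0] X0 by simp
  have growth: "m * (b - a) \<le> y b - y a" if "a \<le> b" for a b
  proof (cases "a = b")
    case False
    then have "a < b" using that by simp
    then obtain z where "y b - y a = (b - a) * v (y z)" using MVT2[of a b y "\<lambda>z. v (y z)"] dy by auto
    then show ?thesis using that m(2)[of "y z"] mult_left_mono[of m "v (y z)" "b - a"] by (simp add: mult.commute)
  qed simp
  show thesis
  proof (rule that[OF y0 dy])
    have lin: "filterlim (\<lambda>x. m * x) at_top at_top"
      using m(1) by (intro filterlim_tendsto_pos_mult_at_top[OF tendsto_const] filterlim_ident) auto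
    show "filterlim y at_top at_top"
      by (rule filterlim_at_top_mono[OF lin])
         (use growth[of 0] y0 in \<open>auto intro!: eventually_at_top_linorderI[of 0]\<close>)
    have lin': "filterlim (\<lambda>x. m * x) at_bot at_bot"
      using m(1) by (intro filterlim_tendsto_pos_mult_at_bot[OF tendsto_const] filterlim_ident) auto
    show "filterlim y at_bot at_bot"
      unfolding filterlim_at_bot
    proof
      fix Z
      have "\<forall>\<^sub>F x in at_bot. m * x \<le> Z" using lin' by (simp add: filterlim_at_bot)
      then show "\<forall>\<^sub>F x in at_bot. y x \<le> Z"
        using eventually_le_at_bot[of 0] by eventually_elim (use growth[of _ 0] y0 in fastforce)
    qed
  qed
qed

text \<open>With \<open>T = tanh y\<close> the equation becomes \<open>y' = E (tanh y)\<close>. This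
  sends the equilibria -1 and 1 to infinity, and by compactness the new right-hand side lies between
  two positive constants.\<close>

lemma tanh_conjugate_solution:
  fixes E :: "real \<Rightarrow> real"
  assumes cE: "continuous_on {-1..1} E" and pos: "\<And>t. t \<in> {-1..1} \<Longrightarrow> E t > 0"
  obtains T where "T 0 = 0" "\<And>x. (T has_real_derivative (1 - (T x)\<^sup>2) * E (T x)) (at x)"
    "\<And>x. \<bar>T x\<bar> < 1" "(T \<longlongrightarrow> 1) at_top" "(T \<longlongrightarrow> -1) at_bot"
proof -
  have tb: "tanh z \<in> {-1..1::real}" for z using tanh_real_bounds[of z] by auto
  have ne: "{-1..1::real} \<noteq> {}" by simp
  obtain l where l: "l \<in> {-1..1}" "\<forall>x\<in>{-1..1}. E l \<le> E x"
    using continuous_attains_inf[OF compact_Icc ne cE] by blast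
  obtain h where h: "h \<in> {-1..1}" "\<forall>x\<in>{-1..1}. E x \<le> E h"
    using continuous_attains_sup[OF compact_Icc ne cE] by blast
  have ct: "continuous_on UNIV (tanh :: real \<Rightarrow> real)" by (intro continuous_intros) auto
  have cv: "continuous_on UNIV (\<lambda>z. E (tanh z))"
    by (rule continuous_on_compose2[OF cE ct]) (use tb in auto)
  obtain y where y: "y 0 = 0" "\<And>x. (y has_real_derivative E (tanh (y x))) (at x)"
    "filterlim y at_top at_top" "filterlim y at_bot at_bot"
    using autonomous_solution[OF cv, of "E l" "E h"] pos[OF l(1)] l(2) h(2) tb by blast
  show thesis
  proof (rule that[of "\<lambda>x. tanh (y x)"])
    show "((\<lambda>x. tanh (y x)) has_real_derivative (1 - (tanh (y x))\<^sup>2) * E (tanh (y x))) (at x)" for x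
      using DERIV_chain2[OF has_field_derivative_tanh[OF _ DERIV_ident] y(2), of x] by simp
    show "\<bar>tanh (y x)\<bar> < 1" for x using tanh_real_bounds[of "y x"] by auto
    show "((\<lambda>x. tanh (y x)) \<longlongrightarrow> 1) at_top" using tanh_real_at_top y(3) by (rule filterlim_compose)
    show "((\<lambda>x. tanh (y x)) \<longlongrightarrow> -1) at_bot" using tanh_real_at_bot y(4) by (rule filterlim_compose)
  qed (simp add: y)
qed

section \<open>Integration over the whole line and weak derivatives\<close>

lemma has_integral_deriv_nonneg_line:
  fixes f F :: "real \<Rightarrow> real"
  assumes F: "\<And>x. (F has_real_derivative f x) (at x)" and f: "continuous_on UNIV f" "\<And>x. f x \<ge> 0"
    and lim: "(F \<longlongrightarrow> A) at_bot" "(F \<longlongrightarrow> B) at_top"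
  shows "integrable lborel f" "(LINT x|lborel. f x) = B - A"
proof -
  have c: "isCont f x" for x using f(1) by (simp add: continuous_on_eq_continuous_at)
  have l: "((F \<circ> real_of_ereal) \<longlongrightarrow> A) (at_right (-\<infinity>))" "((F \<circ> real_of_ereal) \<longlongrightarrow> B) (at_left \<infinity>)"
    using lim by (simp_all add: ereal_tendsto_simps)
  have n: "AE x in lborel. -\<infinity> < ereal x \<longrightarrow> ereal x < \<infinity> \<longrightarrow> 0 \<le> f x" using f(2) by simp
  have "(-\<infinity>::ereal) < \<infinity>" by simp
  \<comment> \<open>For a nonnegative derivative, finite limits of the primitive at both ends
    already yield integrability.\<close>
  note * = interval_integral_FTC_nonneg[OF this F c n l]
  show "integrable lborel f" using *(1) by (simp add: set_integrable_def einterval_def)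
  show "(LINT x|lborel. f x) = B - A"
    using *(2) by (simp add: interval_lebesgue_integral_def set_lebesgue_integral_def einterval_def)
qed

text \<open>The derivative of the product of \<open>\<psi>\<close> and \<open>u\<close> is
  integrated over an interval at whose ends \<open>\<psi>\<close> vanishes.\<close>

lemma C1_has_weak_deriv:
  fixes u :: "real \<Rightarrow> 'a::euclidean_space"
  assumes u: "\<And>x. (u has_vector_derivative u' x) (at x)" and u': "continuous_on UNIV u'"
  shows "has_weak_deriv u u'"
  unfolding has_weak_deriv_def
proof (intro allI impI, elim conjE)
  fix \<psi> \<psi>' :: "real \<Rightarrow> real" and R
  assume \<psi>: "\<forall>x. (\<psi> has_real_derivative \<psi>' x) (at x)" and c': "continuous_on UNIV \<psi>'"
    and z: "\<forall>x. \<bar>x\<bar> > R \<longrightarrow> \<psi> x = 0"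
  \<comment> \<open>The test function is known to vanish only where
    \<open>\<bar>x\<bar> > R\<close>; going strictly beyond \<open>R\<close> makes it vanish at the
    endpoints too.\<close>
  define S where "S = \<bar>R\<bar> + 1"
  have S: "\<psi> x = 0" "\<psi>' x = 0" if "x \<notin> {-S..S}" for x
  proof -
    have o: "\<bar>x\<bar> > R" using that by (auto simp: S_def)
    then show "\<psi> x = 0" using z by blast
    have "((\<lambda>x. 0) has_real_derivative \<psi>' x) (at x)"
      by (rule has_field_derivative_transform_within_open[of \<psi> _ _ "{x. \<bar>x\<bar> > R}"])
         (use \<psi> z o in \<open>auto intro!: open_Collect_less continuous_intros\<close>)
    then show "\<psi>' x = 0" using DERIV_unique[OF _ DERIV_const] by blast
  qed
  have cu: "continuous_on UNIV u"
    using u by (meson has_vector_derivative_continuous continuous_at_imp_continuous_on)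
  have c\<psi>: "continuous_on UNIV \<psi>"
    using \<psi> by (meson DERIV_continuous continuous_at_imp_continuous_on)
  have ind: "indicator {-S..S} x *\<^sub>R (\<psi>' x *\<^sub>R u x) = \<psi>' x *\<^sub>R u x"
    "indicator {-S..S} x *\<^sub>R (\<psi> x *\<^sub>R u' x) = \<psi> x *\<^sub>R u' x" for x
    using S[of x] by (cases "x \<in> {-S..S}"; simp)+
  have "integrable lborel (\<lambda>x. indicator {-S..S} x *\<^sub>R (\<psi>' x *\<^sub>R u x))"
    by (rule borel_integrable_compact)
       (auto intro!: continuous_intros continuous_on_subset[OF c'] continuous_on_subset[OF cu])
  then have i1: "integrable lborel (\<lambda>x. \<psi>' x *\<^sub>R u x)" by (simp only: ind)
  have "integrable lborel (\<lambda>x. indicator {-S..S} x *\<^sub>R (\<psi> x *\<^sub>R u' x))"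
    by (rule borel_integrable_compact)
       (auto intro!: continuous_intros continuous_on_subset[OF c\<psi>] continuous_on_subset[OF u'])
  then have i2: "integrable lborel (\<lambda>x. \<psi> x *\<^sub>R u' x)" by (simp only: ind)
  have "(LINT x|lborel. indicator {-S..S} x *\<^sub>R (\<psi> x *\<^sub>R u' x + \<psi>' x *\<^sub>R u x)) = \<psi> S *\<^sub>R u S - \<psi> (-S) *\<^sub>R u (-S)"
  proof (rule integral_FTC_atLeastAtMost)
    show "((\<lambda>x. \<psi> x *\<^sub>R u x) has_vector_derivative \<psi> x *\<^sub>R u' x + \<psi>' x *\<^sub>R u x) (at x within {-S..S})" for x
      using \<psi> u by (auto intro!: has_vector_derivative_scaleR intro: has_vector_derivative_at_within DERIV_subset)
    show "continuous_on {-S..S} (\<lambda>x. \<psi> x *\<^sub>R u' x + \<psi>' x *\<^sub>R u x)"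
      by (intro continuous_intros; rule continuous_on_subset[OF c'] continuous_on_subset[OF cu]
          continuous_on_subset[OF c\<psi>] continuous_on_subset[OF u']; simp)
  qed (simp add: S_def)
  moreover have "\<psi> S = 0" "\<psi> (-S) = 0" using z by (auto simp: S_def)
  ultimately have "(LINT x|lborel. \<psi> x *\<^sub>R u' x + \<psi>' x *\<^sub>R u x) = 0"
    by (simp only: scaleR_add_right ind scaleR_zero_left diff_zero)
  then show "(LINT x|lborel. \<psi>' x *\<^sub>R u x) = - (LINT x|lborel. \<psi> x *\<^sub>R u' x)"
    using Bochner_Integration.integral_add[OF i2 i1] by (simp add: eq_neg_iff_add_eq_0 add.commute)
qed

lemma continuous_in_L2_loc:
  fixes v :: "real \<Rightarrow> 'a::euclidean_space"
  assumes "continuous_on UNIV v"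
  shows "v \<in> L2_loc"
  unfolding L2_loc_def
proof safe
  show "v \<in> borel_measurable borel" using assms by (rule borel_measurable_continuous_onI)
  show "set_integrable lborel {a..b} (\<lambda>x. (norm (v x))\<^sup>2)" for a b
    by (intro borel_integrable_atLeastAtMost' continuous_intros continuous_on_subset[OF assms]) auto
qed

section \<open>The soliton of minimal density \<open>a\<close>\<close>

text \<open>Half the integral of \<open>c * (1 - r)\<^sup>2 / (2 * r)\<close> over the line, after
  the substitution \<open>r = a + (1 - a) * t\<^sup>2\<close>. As an explicit function of
  \<open>a\<close> it makes sense also at \<open>a = 1\<close>, where its value is 0.\<close>

definition soliton_momentum :: "(real \<Rightarrow> real) \<Rightarrow> (real \<Rightarrow> real) \<Rightarrow> real \<Rightarrow> real" where
  "soliton_momentum G G' a = sqrt (G a) / 2 * ((1 - a) * sqrt (1 - a)) *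
     integral {-1..1} (\<lambda>t. (1 - t\<^sup>2) / ((a + (1 - a) * t\<^sup>2) * sqrt (wmean (\<lambda>_. 1) G' a (a + (1 - a) * t\<^sup>2))))"

text \<open>The relation \<open>FG\<close> is multiplied out so as to hold at 1 as well. Positivity
  of \<open>G'\<close> makes \<open>G\<close> exceed the squared speed \<open>G a\<close> on
  (\<open>a\<close>, 1], so the density can turn only at \<open>a\<close>.\<close>

locale soliton =
  fixes f F G G' G'' :: "real \<Rightarrow> real" and a :: real
  assumes F_deriv: "\<And>x. (F has_real_derivative - f x) (at x)"
    and G_deriv: "\<And>x. (G has_real_derivative G' x) (at x)"
    and G'_deriv: "\<And>x. (G' has_real_derivative G'' x) (at x)"
    and G''_cont: "continuous_on UNIV G''"
    and FG: "\<And>r. 4 * r * F r = (1 - r)\<^sup>2 * G r"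
    and a: "0 < a" "a < 1" and Ga: "G a > 0"
    and G'_pos: "\<And>s. a \<le> s \<Longrightarrow> s \<le> 1 \<Longrightarrow> G' s > 0"
begin

definition c where "c = sqrt (G a)"

text \<open>The quadratic parametrisation resolves the turning point: as \<open>t\<close> passes
  through 0, the density decreases to \<open>a\<close> and increases again, without a change of
  branch of a square root.\<close>

definition R where "R t = a + (1 - a) * t\<^sup>2"

text \<open>This is \<open>(G (R t) - G a) / (4 * t\<^sup>2)\<close> with the double zero at 0
  divided out. In terms of \<open>t\<close> the first order equation for the density reads
  \<open>t' = (1 - t\<^sup>2) * sqrt (K t)\<close>.\<close>

definition K where "K t = (1 - a) * wmean (\<lambda>_. 1) G' a (R t) / 4"

definition K' where "K' t = (1 - a) * (wmean (\<lambda>\<theta>. 1 * \<theta>) G'' a (R t) * ((1 - a) * (2 * t))) / 4"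

definition E where "E t = sqrt (K t)"

lemma c_pos: "c > 0" and c_sq: "c\<^sup>2 = G a"
  using Ga by (simp_all add: c_def)

lemma G_cont: "continuous_on S G" and G'_cont: "continuous_on S G'" and F_cont: "continuous_on S F"
  using G_deriv G'_deriv F_deriv by (meson DERIV_continuous continuous_at_imp_continuous_on)+

lemma R_bounds: "\<bar>t\<bar> \<le> 1 \<Longrightarrow> a \<le> R t \<and> R t \<le> 1"
proof -
  assume "\<bar>t\<bar> \<le> 1"
  then have "t\<^sup>2 \<le> 1" by (simp add: abs_square_le_1)
  then have "(1 - a) * t\<^sup>2 \<le> (1 - a) * 1" using a by (intro mult_left_mono) auto
  moreover have "0 \<le> (1 - a) * t\<^sup>2" using a by simp
  ultimately show ?thesis by (simp add: R_def)
qed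

lemma R_ge: "a \<le> R t"
  using a by (simp add: R_def)

lemma R_pos: "R t > 0"
  using R_ge[of t] a by linarith

lemma K_pos: "\<bar>t\<bar> \<le> 1 \<Longrightarrow> K t > 0"
  using R_bounds[of t] a unfolding K_def
  by (intro divide_pos_pos mult_pos_pos wmean_one_pos G'_cont) (auto intro: G'_pos)

lemma E_pos: "\<bar>t\<bar> \<le> 1 \<Longrightarrow> E t > 0" and E_sq: "\<bar>t\<bar> \<le> 1 \<Longrightarrow> (E t)\<^sup>2 = K t"
  using K_pos[of t] by (auto simp: E_def)

lemma K_secant: "4 * t\<^sup>2 * K t = G (R t) - G a"
  using wmean_secant[OF G_deriv, of "R t" a] by (simp add: K_def R_def mult_ac)

lemma R_deriv: "(R has_real_derivative (1 - a) * (2 * t)) (at t)"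
  unfolding R_def by (auto intro!: derivative_eq_intros)

lemma R_cont: "continuous_on S R"
  unfolding R_def by (intro continuous_intros)

lemma K_deriv: "(K has_real_derivative K' t) (at t)"
  unfolding K_def K'_def
  by (intro DERIV_cdivide DERIV_cmult DERIV_chain2[OF has_real_derivative_wmean R_deriv]
      G'_deriv G''_cont continuous_on_const)

text \<open>Differentiate \<open>K_secant\<close> and cancel \<open>4 * t\<close>; at
  \<open>t = 0\<close> the value of \<open>K\<close> is explicit. The identity trades the mean of
  \<open>G''\<close> in \<open>K'\<close> for \<open>G'\<close> and \<open>K\<close>.\<close>

lemma K'_eq: "t * K' t = (1 - a) * G' (R t) / 2 - 2 * K t"
proof (cases "t = 0")
  case True
  then show ?thesis by (simp add: K_def R_def)
next
  case False
  have "((\<lambda>t. 4 * t\<^sup>2 * K t) has_real_derivative 8 * t * K t + 4 * t\<^sup>2 * K' t) (at t)"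
    by (rule derivative_eq_intros K_deriv refl | simp)+
  moreover have "((\<lambda>t. G (R t) - G a) has_real_derivative G' (R t) * ((1 - a) * (2 * t)) - 0) (at t)"
    by (intro DERIV_diff DERIV_chain2[OF G_deriv R_deriv] DERIV_const)
  ultimately have "8 * t * K t + 4 * t\<^sup>2 * K' t = G' (R t) * ((1 - a) * (2 * t)) - 0"
    using K_secant by (auto dest: DERIV_unique)
  then have "4 * t * (2 * K t + t * K' t) = 4 * t * ((1 - a) * G' (R t) / 2)"
    by (simp add: power2_eq_square algebra_simps)
  then have "2 * K t + t * K' t = (1 - a) * G' (R t) / 2" using False by simp
  then show ?thesis by simp
qed

lemma E_cont: "continuous_on S E"
  unfolding E_def using K_deriv
  by (intro continuous_intros) (meson DERIV_continuous continuous_at_imp_continuous_on)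

lemma E_altdef: "E t = sqrt (1 - a) * sqrt (wmean (\<lambda>_. 1) G' a (R t)) / 2"
  using real_sqrt_four by (simp add: E_def K_def real_sqrt_mult real_sqrt_divide)

lemma FG_deriv: "4 * F r - 4 * r * f r = (1 - r)\<^sup>2 * G' r - 2 * (1 - r) * G r"
proof -
  have "((\<lambda>r. 4 * r * F r) has_real_derivative 4 * F r - 4 * r * f r) (at r)"
    by (rule derivative_eq_intros F_deriv refl | simp)+
  moreover have "((\<lambda>r. (1 - r)\<^sup>2 * G r) has_real_derivative (1 - r)\<^sup>2 * G' r - 2 * (1 - r) * G r) (at r)"
    by (rule derivative_eq_intros G_deriv refl | simp add: left_diff_distrib)+
  ultimately show ?thesis using FG by (auto dest: DERIV_unique)
qed

end

section \<open>From the desingularised profile to a solution of the wave equation\<close>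

locale soliton_profile = soliton +
  fixes T :: "real \<Rightarrow> real"
  assumes T_0: "T 0 = 0" and T_deriv: "\<And>x. (T has_real_derivative (1 - (T x)\<^sup>2) * E (T x)) (at x)"
    and T_abs: "\<And>x. \<bar>T x\<bar> < 1" and T_top: "(T \<longlongrightarrow> 1) at_top" and T_bot: "(T \<longlongrightarrow> -1) at_bot"
begin

definition r where "r x = R (T x)"

definition r' where "r' x = 2 * (1 - a) * (T x * (1 - (T x)\<^sup>2) * E (T x))"

text \<open>Obtained formally by differentiating
  \<open>r'\<^sup>2 = 4 * r * F r - c\<^sup>2 * (1 - r)\<^sup>2\<close> and dividing by
  \<open>2 * r'\<close>.\<close>

definition r'' where "r'' x = 2 * F (r x) - 2 * r x * f (r x) + c\<^sup>2 * (1 - r x)"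

definition \<phi> where "\<phi> x = (LBINT t=ereal 0..ereal x. c * (1 - r t) / (2 * r t))"

definition u where "u x = complex_of_real (sqrt (r x)) * exp (\<i> * of_real (\<phi> x))"

lemma T_abs_le: "\<bar>T x\<bar> \<le> 1"
  using T_abs[of x] by simp

lemma r_bounds: "a \<le> r x" "r x \<le> 1" "0 < r x"
  using R_bounds[OF T_abs_le[of x]] a by (auto simp: r_def)

lemma one_minus_r: "1 - r x = (1 - a) * (1 - (T x)\<^sup>2)"
  by (simp add: r_def R_def algebra_simps)

lemma r_deriv: "(r has_real_derivative r' x) (at x)"
  using DERIV_chain2[OF R_deriv T_deriv, of x] unfolding r_def[abs_def] r'_def by (simp add: mult_ac)

lemma r'_sq: "(r' x)\<^sup>2 = (1 - r x)\<^sup>2 * (G (r x) - c\<^sup>2)"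
proof -
  have "(r' x)\<^sup>2 = (1 - r x)\<^sup>2 * (4 * (T x)\<^sup>2 * (E (T x))\<^sup>2)"
    unfolding one_minus_r r'_def by (simp add: power2_eq_square algebra_simps)
  then show ?thesis
    using K_secant[of "T x"] by (simp add: E_sq T_abs_le c_sq r_def)
qed

text \<open>Dividing by \<open>r'\<close> is impossible at the turning point, so the explicit
  formula for \<open>r'\<close> in terms of \<open>T\<close> is differentiated instead.\<close>

lemma r'_deriv: "(r' has_real_derivative r'' x) (at x)"
proof -
  define t where "t = T x"
  have t: "\<bar>t\<bar> \<le> 1" using T_abs_le t_def by simp
  note Ep = E_pos[OF t] and Es = E_sq[OF t]
  define t' where "t' = (1 - t\<^sup>2) * E t"
  have dT: "(T has_real_derivative t') (at x)" using T_deriv[of x] by (simp add: t_def t'_def)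
  have dE: "(E has_real_derivative K' t * (inverse (E t) / 2)) (at t)"
    using DERIV_chain2[OF DERIV_real_sqrt[OF K_pos[OF t]] K_deriv[of t]]
    unfolding E_def[abs_def] by (simp add: mult.commute)
  have dE: "((\<lambda>x. E (T x)) has_real_derivative (K' t * (inverse (E t) / 2)) * t') (at x)"
    by (rule DERIV_chain2[OF _ dT]) (use dE t_def in simp)
  have "(r' has_real_derivative 2 * (1 - a) * ((t' * (1 - t\<^sup>2) + (- (2 * t * t')) * t) * E t
      + (K' t * (inverse (E t) / 2)) * t' * (t * (1 - t\<^sup>2)))) (at x)"
    unfolding r'_def[abs_def]
    by (rule derivative_eq_intros dT dE refl | simp add: t_def)+
  moreover have "2 * (1 - a) * ((t' * (1 - t\<^sup>2) + (- (2 * t * t')) * t) * E t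
      + (K' t * (inverse (E t) / 2)) * t' * (t * (1 - t\<^sup>2))) = r'' x"
  proof -
    \<comment> \<open>Since \<open>t'\<close> carries a factor \<open>E t\<close>, the reciprocal of
      \<open>E t\<close> cancels and otherwise only its square remains, which is
      \<open>K t\<close>.\<close>
    have "2 * (1 - a) * ((t' * (1 - t\<^sup>2) + (- (2 * t * t')) * t) * E t
        + (K' t * (inverse (E t) / 2)) * t' * (t * (1 - t\<^sup>2)))
        = 2 * (1 - a) * (1 - t\<^sup>2) * ((1 - 3 * t\<^sup>2) * (E t)\<^sup>2 + (1 - t\<^sup>2) * (t * K' t) / 2)"
      using Ep unfolding t'_def by (simp add: field_simps power2_eq_square)
    also have "\<dots> = (1 - a) * (1 - t\<^sup>2) * (- (4 * t\<^sup>2 * K t) + (1 - a) * (1 - t\<^sup>2) * G' (R t) / 2)"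
      unfolding Es K'_eq by (simp add: field_simps)
    also have "\<dots> = (1 - r x) * (- (G (r x) - c\<^sup>2) + (1 - r x) * G' (r x) / 2)"
      unfolding K_secant one_minus_r by (simp add: t_def r_def c_sq)
    also have "\<dots> = r'' x"
    proof -
      have "2 * ((1 - r x) * (- (G (r x) - c\<^sup>2) + (1 - r x) * G' (r x) / 2))
          = ((1 - r x)\<^sup>2 * G' (r x) - 2 * (1 - r x) * G (r x)) + 2 * (c\<^sup>2 * (1 - r x))"
        by (simp add: power2_eq_square field_simps)
      also have "\<dots> = 2 * r'' x" unfolding FG_deriv[symmetric] r''_def by simp
      finally show ?thesis by simp
    qed
    finally show ?thesis .
  qed
  ultimately show ?thesis by simp
qed

lemma T_cont: "continuous_on S T" and r_cont: "continuous_on S r"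
  using T_deriv r_deriv by (meson DERIV_continuous continuous_at_imp_continuous_on)+

lemma phase_cont: "continuous_on S (\<lambda>x. c * (1 - r x) / (2 * r x))"
  using r_bounds(3) by (intro continuous_intros r_cont) (auto simp: less_le)

lemma \<phi>_deriv: "(\<phi> has_real_derivative c * (1 - r x) / (2 * r x)) (at x)"
  unfolding \<phi>_def[abs_def] by (rule interval_integral_has_real_derivative) (rule phase_cont)

lemma norm_u: "cmod (u x) = sqrt (r x)" and norm_u_sq: "(cmod (u x))\<^sup>2 = r x"
  using r_bounds(3)[of x] by (simp_all add: u_def norm_mult)

text \<open>The logarithmic derivative of \<open>u\<close>. Dividing by \<open>u\<close> reduces the
  wave equation to one for \<open>L'\<close> and its derivative \<open>L''\<close>, free of the
  phase itself.\<close>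

definition L' where "L' x = complex_of_real (r' x / (2 * r x)) + \<i> * of_real (c * (1 - r x) / (2 * r x))"

definition L'' where
  "L'' x = complex_of_real (r'' x / (2 * r x) - (r' x)\<^sup>2 / (2 * (r x)\<^sup>2)) - \<i> * of_real (c * r' x / (2 * (r x)\<^sup>2))"

lemma u_deriv: "(u has_vector_derivative L' x * u x) (at x)"
proof -
  have dl: "((\<lambda>x. ln (r x) / 2) has_real_derivative r' x / (2 * r x)) (at x)"
    using r_bounds(3)[of x] by (auto intro!: derivative_eq_intros r_deriv)
  have "((\<lambda>x. complex_of_real (ln (r x) / 2) + \<i> * of_real (\<phi> x)) has_vector_derivative L' x) (at x)"
    unfolding L'_def
    by (intro has_vector_derivative_add has_vector_derivative_mult_right has_vector_derivative_of_real)
       (use dl \<phi>_deriv in \<open>auto simp: has_real_derivative_iff_has_vector_derivative\<close>)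
  from field_vector_diff_chain_at[OF this DERIV_exp]
  have "((\<lambda>x. exp (complex_of_real (ln (r x) / 2) + \<i> * of_real (\<phi> x))) has_vector_derivative
      L' x * exp (complex_of_real (ln (r x) / 2) + \<i> * of_real (\<phi> x))) (at x)"
    by (simp add: o_def)
  moreover have "exp (complex_of_real (ln (r x) / 2) + \<i> * of_real (\<phi> x)) = u x" for x
  proof -
    have "exp (ln (r x) / 2) = sqrt (r x)"
      using r_bounds(3)[of x] exp_ln[of "sqrt (r x)"] by (simp only: ln_sqrt real_sqrt_gt_0_iff)
    then show ?thesis unfolding u_def exp_add exp_of_real by simp
  qed
  ultimately show ?thesis by simp
qed

lemma L'_deriv: "(L' has_vector_derivative L'' x) (at x)"
proof -
  have rp: "r x \<noteq> 0" using r_bounds(3)[of x] by simp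
  have 1: "((\<lambda>x. r' x / (2 * r x)) has_real_derivative r'' x / (2 * r x) - (r' x)\<^sup>2 / (2 * (r x)\<^sup>2)) (at x)"
    by (rule derivative_eq_intros r_deriv r'_deriv refl | use rp in \<open>simp add: field_simps power2_eq_square\<close>)+
  have 2: "((\<lambda>x. c * (1 - r x) / (2 * r x)) has_real_derivative - (c * r' x / (2 * (r x)\<^sup>2))) (at x)"
    by (rule derivative_eq_intros r_deriv refl | use rp in \<open>simp add: field_simps power2_eq_square\<close>)+
  have "(L' has_vector_derivative complex_of_real (r'' x / (2 * r x) - (r' x)\<^sup>2 / (2 * (r x)\<^sup>2))
      + \<i> * of_real (- (c * r' x / (2 * (r x)\<^sup>2)))) (at x)"
    unfolding L'_def[abs_def]
    by (intro has_vector_derivative_add has_vector_derivative_mult_right has_vector_derivative_of_real)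
       (use 1 2 in \<open>auto simp: has_real_derivative_iff_has_vector_derivative\<close>)
  then show ?thesis by (simp add: L''_def)
qed

lemma u'_deriv: "((\<lambda>x. L' x * u x) has_vector_derivative L' x * (L' x * u x) + L'' x * u x) (at x)"
  by (rule has_vector_derivative_mult[OF L'_deriv u_deriv])

text \<open>The real part combines the first integral for \<open>r'\<close> with the formula for
  \<open>r''\<close>.\<close>

lemma L_equation: "\<i> * of_real c * L' x + (L' x * L' x + L'' x) + of_real (f (r x)) = 0"
proof -
  define z where "z = r x"
  define w where "w = r' x"
  have z: "z \<noteq> 0" using r_bounds(3)[of x] by (simp add: z_def)
  have w: "w\<^sup>2 = 4 * z * F z - c\<^sup>2 * (1 - z)\<^sup>2"
    using FG[of z] r'_sq[of x] by (simp add: z_def w_def algebra_simps)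
  have s: "r'' x = 2 * F z - 2 * z * f z + c\<^sup>2 * (1 - z)" by (simp add: r''_def z_def)
  have Re: "- c * (c * (1 - z) / (2 * z)) + ((w / (2 * z))\<^sup>2 - (c * (1 - z) / (2 * z))\<^sup>2
      + (r'' x / (2 * z) - w\<^sup>2 / (2 * z\<^sup>2))) + f z = 0"
  proof -
    have "- c * (c * (1 - z) / (2 * z)) + ((w / (2 * z))\<^sup>2 - (c * (1 - z) / (2 * z))\<^sup>2
      + (r'' x / (2 * z) - w\<^sup>2 / (2 * z\<^sup>2))) + f z
      = (- 2 * c\<^sup>2 * (1 - z) * z - w\<^sup>2 - c\<^sup>2 * (1 - z)\<^sup>2 + 2 * z * r'' x + 4 * z\<^sup>2 * f z) / (4 * z\<^sup>2)"
      using z by (simp add: field_simps power2_eq_square)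
    also have "\<dots> = 0" unfolding w s by (simp add: algebra_simps power2_eq_square)
    finally show ?thesis .
  qed
  \<comment> \<open>The imaginary part vanishes identically, by the choice of the phase derivative
    \<open>c * (1 - r) / (2 * r)\<close>.\<close>
  have Im: "c * w / (2 * z) + (c * (w * (1 - z)) / (2 * (z * z)) - c * w / (2 * (z * z))) = 0"
    using z by (simp add: field_simps power2_eq_square)
  show ?thesis
    using Re Im by (simp add: complex_eq_iff L'_def L''_def z_def w_def power2_eq_square)
qed

text \<open>The function \<open>(1 - T\<^sup>2) * E T\<close> is the derivative of \<open>T\<close>,
  which has finite limits, and \<open>E\<close> is bounded below on [-1, 1]. Hence
  \<open>1 - T\<^sup>2\<close> serves as an integrable majorant.\<close>

lemma integrable_profile_bound:
  fixes g :: "real \<Rightarrow> real"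
  assumes g: "continuous_on UNIV g" and b: "\<And>x. \<bar>g x\<bar> \<le> B * (1 - (T x)\<^sup>2)"
  shows "integrable lborel g"
proof -
  have ne: "{-1..1::real} \<noteq> {}" by simp
  obtain l where l: "l \<in> {-1..1}" "\<forall>t\<in>{-1..1}. E l \<le> E t"
    using continuous_attains_inf[OF compact_Icc ne E_cont] by blast
  have El: "E l > 0" using E_pos l by auto
  have T2: "0 \<le> 1 - (T x)\<^sup>2" for x using T_abs_le[of x] by (simp add: abs_square_le_1)
  have "integrable lborel (\<lambda>x. (1 - (T x)\<^sup>2) * E (T x))"
    by (rule has_integral_deriv_nonneg_line(1)[OF T_deriv _ _ T_bot T_top])
       (auto intro!: continuous_intros T_cont continuous_on_compose2[OF E_cont T_cont] mult_nonneg_nonneg T2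
         less_imp_le[OF E_pos] T_abs_le)
  then have "integrable lborel (\<lambda>x. (\<bar>B\<bar> / E l) * ((1 - (T x)\<^sup>2) * E (T x)))"
    by (rule integrable_mult_right)
  then show ?thesis
  proof (rule Bochner_Integration.integrable_bound)
    show "g \<in> borel_measurable lborel" using g by (simp add: borel_measurable_continuous_onI)
    show "AE x in lborel. norm (g x) \<le> norm ((\<bar>B\<bar> / E l) * ((1 - (T x)\<^sup>2) * E (T x)))"
    proof (rule AE_I2)
      fix x
      have "T x \<in> {-1..1}" using T_abs_le[of x] by (simp add: abs_le_iff)
      then have "E l \<le> E (T x)" using l by blast
      then have "1 \<le> E (T x) / E l" using El by simp
      have "\<bar>g x\<bar> \<le> B * (1 - (T x)\<^sup>2)" by (rule b)
      also have "\<dots> \<le> \<bar>B\<bar> * (1 - (T x)\<^sup>2)" using T2[of x] by (intro mult_right_mono) auto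
      also have "\<dots> \<le> \<bar>B\<bar> * (1 - (T x)\<^sup>2) * (E (T x) / E l)"
        using mult_left_mono[OF \<open>1 \<le> E (T x) / E l\<close>, of "\<bar>B\<bar> * (1 - (T x)\<^sup>2)"] T2[of x] by simp
      also have "\<dots> = (\<bar>B\<bar> / E l) * ((1 - (T x)\<^sup>2) * E (T x))" by simp
      finally show "norm (g x) \<le> norm ((\<bar>B\<bar> / E l) * ((1 - (T x)\<^sup>2) * E (T x)))" by (simp only: real_norm_def)
    qed
  qed
qed

lemma u_travelling_equation:
  "\<i> * of_real c * (L' x * u x) + (L' x * (L' x * u x) + L'' x * u x) + u x * of_real (f ((cmod (u x))\<^sup>2)) = 0"
proof -
  have "\<i> * of_real c * (L' x * u x) + (L' x * (L' x * u x) + L'' x * u x) + u x * of_real (f ((cmod (u x))\<^sup>2))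
      = u x * (\<i> * of_real c * L' x + (L' x * L' x + L'' x) + of_real (f (r x)))"
    unfolding norm_u_sq by (simp add: algebra_simps)
  then show ?thesis unfolding L_equation by simp
qed

section \<open>Finite energy and non-vanishing\<close>

lemma L'_cont: "continuous_on S L'" and u_cont: "continuous_on S u"
  using L'_deriv u_deriv by (meson has_vector_derivative_continuous continuous_at_imp_continuous_on)+

text \<open>Equipartition of the energy, a form of the first integral. Integrability of the
  potential term then also puts the derivative in \<open>L2\<close>.\<close>

lemma norm_u'_sq: "(norm (L' x * u x))\<^sup>2 = F (r x)"
proof -
  have "(norm (L' x * u x))\<^sup>2 = ((r' x / (2 * r x))\<^sup>2 + (c * (1 - r x) / (2 * r x))\<^sup>2) * r x"
    unfolding norm_mult power_mult_distrib norm_u_sq by (simp add: L'_def cmod_power2)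
  also have "\<dots> = ((r' x)\<^sup>2 + c\<^sup>2 * (1 - r x)\<^sup>2) / (4 * r x)"
    using r_bounds(3)[of x] by (simp add: field_simps power2_eq_square)
  also have "(r' x)\<^sup>2 + c\<^sup>2 * (1 - r x)\<^sup>2 = 4 * r x * F (r x)"
    unfolding r'_sq FG by (simp add: algebra_simps)
  finally show ?thesis using r_bounds(3)[of x] by simp
qed

lemma one_minus_r_sq_le: "(1 - r x)\<^sup>2 \<le> 1 - (T x)\<^sup>2"
proof -
  have T2: "0 \<le> 1 - (T x)\<^sup>2" "1 - (T x)\<^sup>2 \<le> 1" using T_abs_le[of x] by (simp_all add: abs_square_le_1)
  have 1: "0 \<le> 1 - r x" "1 - r x \<le> 1" using r_bounds[of x] a by auto
  have "1 - r x \<le> 1 * (1 - (T x)\<^sup>2)"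
    unfolding one_minus_r using a T2 by (intro mult_right_mono) auto
  moreover have "(1 - r x) * (1 - r x) \<le> 1 * (1 - r x)" using 1 by (intro mult_right_mono) auto
  ultimately show ?thesis by (simp add: power2_eq_square)
qed

lemma integrable_F: "integrable lborel (\<lambda>x. F (r x))"
proof -
  have ne: "{a..1} \<noteq> {}" using a by simp
  \<comment> \<open>Here \<open>B\<close> is a point where the modulus of \<open>G\<close> is
    maximal on [\<open>a\<close>, 1]; the bound itself is \<open>\<bar>G B\<bar>\<close>.\<close>
  obtain B where B: "\<forall>s\<in>{a..1}. \<bar>G s\<bar> \<le> \<bar>G B\<bar>"
    using continuous_attains_sup[OF compact_Icc ne continuous_on_rabs[OF G_cont]] by blast
  have c: "continuous_on UNIV (\<lambda>x. F (r x))"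
    by (rule continuous_on_compose2[OF F_cont r_cont]) (rule subset_UNIV)
  have b: "\<bar>F (r x)\<bar> \<le> (\<bar>G B\<bar> / (4 * a)) * (1 - (T x)\<^sup>2)" for x
  proof -
    have "F (r x) = (1 - r x)\<^sup>2 * (G (r x) / (4 * r x))"
      using FG[of "r x"] r_bounds(3)[of x] by (simp add: field_simps)
    moreover have "\<bar>G (r x) / (4 * r x)\<bar> \<le> \<bar>G B\<bar> / (4 * a)"
      unfolding abs_divide using B r_bounds[of x] a by (intro frac_le) auto
    ultimately have "\<bar>F (r x)\<bar> \<le> (1 - (T x)\<^sup>2) * (\<bar>G B\<bar> / (4 * a))"
      using one_minus_r_sq_le[of x] a T_abs_le[of x]
      by (simp only: abs_mult abs_power2) (intro mult_mono, auto simp: abs_square_le_1)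
    then show ?thesis by (simp add: mult.commute)
  qed
  show ?thesis by (rule integrable_profile_bound[OF c b])
qed

lemma u_has_weak_deriv: "has_weak_deriv u (\<lambda>x. L' x * u x)"
  by (rule C1_has_weak_deriv[OF u_deriv]) (intro continuous_intros L'_cont u_cont)

lemma u_in_NX1:
  assumes F: "F = potential f"
  shows "u \<in> NX1 f"
proof -
  have c: "continuous_on UNIV (\<lambda>x. L' x * u x)" by (intro continuous_intros L'_cont u_cont)
  have "u \<in> H1_loc"
    unfolding H1_loc_def using u_cont u_has_weak_deriv continuous_in_L2_loc[OF c] by blast
  moreover have "(\<lambda>x. L' x * u x) \<in> L2"
    using integrable_F borel_measurable_continuous_onI[OF c] by (simp only: L2_def mem_Collect_eq norm_u'_sq simp_thms)
  moreover have "integrable lborel (\<lambda>x. potential f ((cmod (u x))\<^sup>2))"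
    using integrable_F by (simp add: norm_u_sq F)
  moreover have "0 < (INF x. cmod (u x))"
  proof (rule less_le_trans)
    show "sqrt a \<le> (INF x. cmod (u x))"
      by (rule cINF_greatest) (auto simp: norm_u r_bounds)
  qed (use a in simp)
  ultimately show ?thesis
    unfolding NX1_def X1_def using u_has_weak_deriv by auto
qed

text \<open>Constancy would force \<open>r = a\<close> everywhere, yet twice \<open>r''\<close> at
  the turning point is \<open>(1 - a)\<^sup>2 * G' a\<close>, which is positive.\<close>

lemma u_not_constant: "\<not> u constant_on UNIV"
proof
  assume "u constant_on UNIV"
  then obtain k where k: "\<And>x. u x = k" by (auto simp: constant_on_def)
  have rk: "r x = a" for x
    using norm_u_sq[of x] norm_u_sq[of 0] k[of x] k[of 0] T_0 by (simp add: r_def R_def)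
  have "r = (\<lambda>_. a)" using rk by auto
  then have "(r has_real_derivative 0) (at x)" for x by simp
  then have "r' = (\<lambda>_. 0)" using DERIV_unique[OF r_deriv] by blast
  then have "(r' has_real_derivative 0) (at 0)" by simp
  then have "r'' 0 = 0" using DERIV_unique[OF r'_deriv] by blast
  moreover have "2 * a * r'' 0 = (1 - a)\<^sup>2 * G' a * a"
  proof -
    have "2 * r'' 0 = 4 * F a - 4 * a * f a + 2 * (1 - a) * c\<^sup>2"
      using rk[of 0] by (simp add: r''_def)
    then show ?thesis using FG_deriv[of a] by (simp add: c_sq algebra_simps)
  qed
  ultimately show False using a G'_pos[of a] by simp
qed

lemma u_travelling_wave: "F = potential f \<Longrightarrow> travelling_wave f c u"
  unfolding travelling_wave_def
  by (intro conjI exI[of _ "\<lambda>x. L' x * u x"] exI[of _ "\<lambda>x. L' x * (L' x * u x) + L'' x * u x"] allI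
      u_in_NX1 u_not_constant u_deriv u'_deriv u_travelling_equation)

lemma u_has_momentum: "has_momentum u (soliton_momentum G G' a)"
proof -
  \<comment> \<open>The momentum density divided by the derivative of \<open>T\<close>, as a
    function of \<open>t = T x\<close>. The quotient is continuous up to -1 and 1.\<close>
  define q where "q t = c * (1 - a)\<^sup>2 * (1 - t\<^sup>2) / (2 * R t * E t)" for t
  have "2 * R t * E t \<noteq> 0" if "t \<in> {-1..1}" for t
    using that R_pos[of t] E_pos[of t] by (auto simp: abs_le_iff)
  then have cq: "continuous_on {-1..1} q"
    unfolding q_def[abs_def] by (intro continuous_intros E_cont R_cont) auto
  have q0: "q t \<ge> 0" if "\<bar>t\<bar> \<le> 1" for t
    using that R_pos[of t] E_pos[OF that] c_pos by (simp add: q_def abs_square_le_1)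
  define Q where "Q t = integral {-1..t} q" for t
  have dQ: "(Q has_real_derivative q t) (at t)" if "\<bar>t\<bar> < 1" for t
  proof -
    have "(Q has_real_derivative q t) (at t within {-1..1})"
      unfolding Q_def[abs_def] using that by (intro integral_has_real_derivative[OF cq]) (auto simp: abs_less_iff)
    then show ?thesis using that by (subst (asm) at_within_interior) (auto simp: abs_less_iff)
  qed
  have cQ: "continuous_on {-1..1} Q"
    unfolding Q_def[abs_def] by (rule indefinite_integral_continuous_1) (rule integrable_continuous_interval[OF cq])
  have T_in: "T x \<in> {-1..1}" for x using T_abs_le[of x] by (simp add: abs_le_iff)
  have eq: "(1 - (cmod (u x))\<^sup>2) * (c * (1 - r x) / (2 * r x)) = q (T x) * ((1 - (T x)\<^sup>2) * E (T x))" for x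
    unfolding norm_u_sq q_def one_minus_r using R_pos[of "T x"] E_pos[OF T_abs_le[of x]]
    by (simp add: r_def field_simps power2_eq_square)
  \<comment> \<open>The primitive \<open>Q\<close> is differentiable only inside (-1, 1), where
    \<open>T\<close> takes its values; continuity up to the endpoints supplies the limits.\<close>
  have lim: "((\<lambda>x. Q (T x)) \<longlongrightarrow> Q (-1)) at_bot" "((\<lambda>x. Q (T x)) \<longlongrightarrow> Q 1) at_top"
    using T_in by (auto intro!: continuous_on_tendsto_compose[OF cQ] T_bot T_top)
  have d: "((\<lambda>x. Q (T x)) has_real_derivative q (T x) * ((1 - (T x)\<^sup>2) * E (T x))) (at x)" for x
    by (rule DERIV_chain2[OF dQ[OF T_abs] T_deriv])
  have ci: "continuous_on UNIV (\<lambda>x. q (T x) * ((1 - (T x)\<^sup>2) * E (T x)))"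
    using T_in by (intro continuous_intros continuous_on_compose2[OF cq T_cont] continuous_on_compose2[OF E_cont T_cont] T_cont) auto
  have nn: "0 \<le> q (T x) * ((1 - (T x)\<^sup>2) * E (T x))" for x
    using q0[OF T_abs_le] E_pos[OF T_abs_le[of x]] T_abs_le[of x]
    by (intro mult_nonneg_nonneg) (auto simp: abs_square_le_1)
  note int = has_integral_deriv_nonneg_line[OF d ci nn lim]
  have c\<phi>': "continuous_on UNIV (\<lambda>x. c * (1 - r x) / (2 * r x))" by (rule phase_cont)
  have w: "has_weak_deriv \<phi> (\<lambda>x. c * (1 - r x) / (2 * r x))"
    by (rule C1_has_weak_deriv[OF _ c\<phi>']) (use \<phi>_deriv in \<open>simp add: has_real_derivative_iff_has_vector_derivative\<close>)
  have c\<phi>: "continuous_on UNIV \<phi>"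
    using \<phi>_deriv by (meson DERIV_continuous continuous_at_imp_continuous_on)
  have "\<phi> \<in> H1_loc"
    unfolding H1_loc_def using c\<phi> w continuous_in_L2_loc[OF c\<phi>'] by blast
  moreover have "u x = of_real (cmod (u x)) * exp (\<i> * of_real (\<phi> x))" for x
    unfolding norm_u by (simp add: u_def)
  moreover have "soliton_momentum G G' a = 1 / 2 * (LINT x|lborel. (1 - (cmod (u x))\<^sup>2) * (c * (1 - r x) / (2 * r x)))"
  proof -
    have q_half: "1 / 2 * q t = sqrt (G a) / 2 * ((1 - a) * sqrt (1 - a))
        * ((1 - t\<^sup>2) / (R t * sqrt (wmean (\<lambda>_. 1) G' a (R t))))" for t
    proof -
      have "(1 - a)\<^sup>2 / sqrt (1 - a) = (1 - a) * sqrt (1 - a)"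
        using a real_div_sqrt[of "1 - a"] by (simp add: power2_eq_square flip: times_divide_eq_right)
      moreover have "1 / 2 * q t = c / 2 * ((1 - a)\<^sup>2 / sqrt (1 - a))
        * ((1 - t\<^sup>2) / (R t * sqrt (wmean (\<lambda>_. 1) G' a (R t))))"
        unfolding q_def E_altdef by simp
      ultimately show ?thesis by (simp only: c_def)
    qed
    have "1 / 2 * (LINT x|lborel. (1 - (cmod (u x))\<^sup>2) * (c * (1 - r x) / (2 * r x))) = 1 / 2 * (Q 1 - Q (-1))"
      unfolding eq using int(2) by simp
    also have "\<dots> = integral {-1..1} (\<lambda>t. 1 / 2 * q t)"
      unfolding Q_def by (subst integral_mult_right) simp
    also have "\<dots> = soliton_momentum G G' a"
      unfolding q_half soliton_momentum_def R_def by (rule integral_mult_right)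
    finally show ?thesis by simp
  qed
  moreover have "integrable lborel (\<lambda>x. (1 - (cmod (u x))\<^sup>2) * (c * (1 - r x) / (2 * r x)))"
    unfolding eq by (rule int(1))
  ultimately show ?thesis
    unfolding has_momentum_def using w continuous_in_L2_loc[OF c\<phi>'] by blast
qed

end

lemma (in soliton) travelling_wave_exists:
  assumes "F = potential f"
  obtains v where "travelling_wave f (sqrt (G a)) v" "has_momentum v (soliton_momentum G G' a)"
proof -
  obtain T where T: "T 0 = 0" "\<And>x. (T has_real_derivative (1 - (T x)\<^sup>2) * E (T x)) (at x)"
    "\<And>x. \<bar>T x\<bar> < 1" "(T \<longlongrightarrow> 1) at_top" "(T \<longlongrightarrow> -1) at_bot"
    using tanh_conjugate_solution[OF E_cont] E_pos by (metis abs_le_iff atLeastAtMost_iff minus_le_iff)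
  interpret soliton_profile f F G G' G'' a T by unfold_locales (use T in auto)
  show thesis using that u_travelling_wave[OF assms] u_has_momentum by (simp add: c_def)
qed

section \<open>The range of the momentum\<close>

lemma profile_bounds:
  fixes a t :: real
  assumes "0 < a" "a \<le> 1" "t \<in> {-1..1}"
  shows "a \<le> a + (1 - a) * t\<^sup>2" "a + (1 - a) * t\<^sup>2 \<le> 1" "0 < a + (1 - a) * t\<^sup>2"
proof -
  have "t\<^sup>2 \<le> 1" using assms(3) by (simp add: abs_square_le_1 abs_le_iff)
  then have 1: "(1 - a) * t\<^sup>2 \<le> 1 - a" using assms by (simp add: mult_left_le)
  have 2: "0 \<le> (1 - a) * t\<^sup>2" using assms by simp
  show "a \<le> a + (1 - a) * t\<^sup>2" using 2 by simp
  show "a + (1 - a) * t\<^sup>2 \<le> 1" using 1 by simp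
  show "0 < a + (1 - a) * t\<^sup>2" using 2 assms(1) by simp
qed

text \<open>The parameter range is closed at 1, where the mean reduces to \<open>G' 1\<close>, so
  that the intermediate value theorem can start from momentum 0.\<close>

lemma continuous_on_momentum_integrand:
  assumes G': "continuous_on UNIV G'" and r0: "0 < r0"
    and pos: "\<And>s. r0 \<le> s \<Longrightarrow> s \<le> 1 \<Longrightarrow> G' s > 0"
  shows "continuous_on ({r0..1} \<times> {-1..1})
    (\<lambda>(a, t). (1 - t\<^sup>2) / ((a + (1 - a) * t\<^sup>2) * sqrt (wmean (\<lambda>_. 1) G' a (a + (1 - a) * t\<^sup>2))))"
proof -
  have "(a + (1 - a) * t\<^sup>2) * sqrt (wmean (\<lambda>_. 1) G' a (a + (1 - a) * t\<^sup>2)) \<noteq> 0"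
    if "a \<in> {r0..1}" "t \<in> {-1..1}" for a t
  proof -
    note b = profile_bounds[of a t]
    have "wmean (\<lambda>_. 1) G' a (a + (1 - a) * t\<^sup>2) > 0"
      by (rule wmean_one_pos[OF G']) (use that b r0 pos in auto)
    then show ?thesis using b(3) that r0 by auto
  qed
  then show ?thesis
    unfolding case_prod_unfold
    by (intro continuous_intros continuous_on_wmean2 G') auto
qed

lemma continuous_on_soliton_momentum:
  assumes G: "continuous_on UNIV G" and G': "continuous_on UNIV G'" and r0: "0 < r0"
    and pos: "\<And>s. r0 \<le> s \<Longrightarrow> s \<le> 1 \<Longrightarrow> G' s > 0"
  shows "continuous_on {r0..1} (soliton_momentum G G')"
proof -
  have "continuous_on {r0..1} (\<lambda>a. integral (cbox (-1) 1) (\<lambda>t. (1 - t\<^sup>2) /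
      ((a + (1 - a) * t\<^sup>2) * sqrt (wmean (\<lambda>_. 1) G' a (a + (1 - a) * t\<^sup>2)))))"
    by (rule integral_continuous_on_param)
       (use continuous_on_momentum_integrand[OF G' r0 pos] in \<open>simp add: cbox_interval\<close>)
  then show ?thesis
    unfolding soliton_momentum_def[abs_def]
    by (intro continuous_intros continuous_on_subset[OF G]) (auto simp: cbox_interval)
qed

text \<open>The integrand is nonnegative, so a minorant on a subinterval suffices. Both lower bounds
  below rest on this.\<close>

lemma soliton_momentum_ge:
  assumes G': "continuous_on UNIV G'" and a: "0 < a" "a < 1" and Ga: "G a \<ge> 0"
    and pos: "\<And>s. a \<le> s \<Longrightarrow> s \<le> 1 \<Longrightarrow> G' s > 0"
    and sub: "{l..h} \<subseteq> {-1..1}" and k: "(k has_integral I) {l..h}"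
    and le: "\<And>t. t \<in> {l..h} \<Longrightarrow> k t \<le> (1 - t\<^sup>2) / ((a + (1 - a) * t\<^sup>2) * sqrt (wmean (\<lambda>_. 1) G' a (a + (1 - a) * t\<^sup>2)))"
  shows "sqrt (G a) / 2 * ((1 - a) * sqrt (1 - a)) * I \<le> soliton_momentum G G' a"
proof -
  define q where "q t = (1 - t\<^sup>2) / ((a + (1 - a) * t\<^sup>2) * sqrt (wmean (\<lambda>_. 1) G' a (a + (1 - a) * t\<^sup>2)))" for t
  have cq: "continuous_on {-1..1} q"
  proof -
    have p: "continuous_on {-1..1} (\<lambda>t. (a, t))" by (intro continuous_intros)
    have "(\<lambda>t. (a, t)) ` {-1..1} \<subseteq> {a..1} \<times> {-1..1}" using a by auto
    from continuous_on_compose2[OF continuous_on_momentum_integrand[OF G' a(1) pos] p this]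
    show ?thesis unfolding q_def[abs_def] case_prod_conv by simp
  qed
  have i1: "q integrable_on {-1..1}" by (rule integrable_continuous_interval[OF cq])
  have i2: "q integrable_on {l..h}"
    by (rule integrable_continuous_interval) (rule continuous_on_subset[OF cq sub])
  have nn: "0 \<le> q t" if "t \<in> {-1..1}" for t
  proof -
    note b = profile_bounds[of a t]
    have "wmean (\<lambda>_. 1) G' a (a + (1 - a) * t\<^sup>2) > 0"
      by (rule wmean_one_pos[OF G']) (use that b a pos in auto)
    then show ?thesis using b(3) that a by (auto simp: q_def abs_square_le_1 abs_le_iff)
  qed
  have "I = integral {l..h} k" using k by (simp add: integral_unique)
  also have "\<dots> \<le> integral {l..h} q"
    by (rule integral_le[OF has_integral_integrable[OF k] i2]) (use le in \<open>simp add: q_def\<close>)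
  also have "\<dots> \<le> integral {-1..1} q" by (rule integral_subset_le[OF sub i2 i1]) (use nn in blast)
  finally show ?thesis
    unfolding soliton_momentum_def q_def[abs_def] using a Ga by (intro mult_left_mono) auto
qed

text \<open>As \<^term>\<open>a\<close> tends to 0 the momentum tends to \<open>\<pi> / 2\<close>, the momentum of the black soliton.
  Restricting the integral to \<open>t\<^sup>2 \<le> a\<close> already captures a fixed fraction of it.\<close>
lemma soliton_momentum_near_black:
  assumes G: "\<And>x. (G has_real_derivative G' x) (at x)" and G0: "G 0 = 0"
    and G': "continuous_on UNIV G'" and pos: "\<And>s. 0 \<le> s \<Longrightarrow> s \<le> 1 \<Longrightarrow> G' s > 0"
  obtains a where "0 < a" "a < 1" "1 / 32 \<le> soliton_momentum G G' a"
proof -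
  define g where "g = G' 0"
  have g: "g > 0" using pos[of 0] by (simp add: g_def)
  have "isCont G' 0" using G' by (simp add: continuous_on_eq_continuous_at)
  then obtain d where d: "d > 0" "\<forall>s. dist s 0 < d \<longrightarrow> dist (G' s) (G' 0) < g / 2"
    using half_gt_zero[OF g] unfolding continuous_at_eps_delta by blast
  \<comment> \<open>The bound \<open>1 / 4\<close> is for the final constants; \<open>d / 3\<close>
    gives \<open>2 * a < d\<close>, and densities with \<open>t\<^sup>2 \<le> a\<close> do not
    exceed \<open>2 * a\<close>.\<close>
  define a where "a = min (1 / 4) (d / 3)"
  have a: "0 < a" "a \<le> 1 / 4" "2 * a < d" using d(1) by (auto simp: a_def)
  have near: "g / 2 \<le> G' s \<and> G' s \<le> 2 * g" if "0 \<le> s" "s \<le> 2 * a" for s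
  proof -
    have "\<bar>G' s - g\<bar> < g / 2" using d(2) that a by (simp add: dist_real_def g_def)
    then show ?thesis using g unfolding abs_less_iff by linarith
  qed
  have "g / 2 \<le> wmean (\<lambda>_. 1) G' 0 a"
    by (rule wmean_one_bounds(1)[OF G', where M = "2 * g"]) (use near a in auto)
  then have "a * (g / 2) \<le> a * wmean (\<lambda>_. 1) G' 0 a" using a by (intro mult_left_mono) auto
  then have Ga: "a * (g / 2) \<le> G a" using wmean_secant[OF G, of a 0] G0 by simp
  \<comment> \<open>The length \<open>2 * sqrt a\<close> times a constant minorant, from
    \<open>1 - t\<^sup>2 \<ge> 1 - a\<close>, density at most \<open>2 * a\<close> and mean of
    \<open>G'\<close> at most \<open>2 * g\<close>.\<close>
  define I where "I = (1 - a) / (2 * a * sqrt (2 * g)) * (2 * sqrt a)"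
  have sa: "sqrt a \<le> 1" using a by simp
  have "sqrt (G a) / 2 * ((1 - a) * sqrt (1 - a)) * I \<le> soliton_momentum G G' a"
  proof (rule soliton_momentum_ge[OF G', where l = "- sqrt a" and h = "sqrt a"])
    show "0 \<le> G a" using Ga a g by (meson mult_nonneg_nonneg less_imp_le half_gt_zero order_trans)
    show "{- sqrt a..sqrt a} \<subseteq> {-1..1}" using sa by auto
    show "((\<lambda>_. (1 - a) / (2 * a * sqrt (2 * g))) has_integral I) {- sqrt a..sqrt a}"
      using has_integral_const_real[of "(1 - a) / (2 * a * sqrt (2 * g))" "- sqrt a" "sqrt a"] a
      unfolding I_def by (simp add: mult.commute)
    fix t assume t: "t \<in> {- sqrt a..sqrt a}"
    have t2: "t\<^sup>2 \<le> a"
      using t a by (metis abs_le_iff atLeastAtMost_iff minus_le_iff real_sqrt_abs real_sqrt_le_iff)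
    define s where "s = a + (1 - a) * t\<^sup>2"
    have "(1 - a) * t\<^sup>2 \<le> 1 * a" using t2 a by (intro mult_mono) auto
    then have s: "a \<le> s" "s \<le> 2 * a" using a by (simp_all add: s_def)
    have D: "g / 2 \<le> wmean (\<lambda>_. 1) G' a s" "wmean (\<lambda>_. 1) G' a s \<le> 2 * g"
      by (rule wmean_one_bounds[OF G', where m = "g / 2" and M = "2 * g"]; use near a s in auto)+
    have "0 < sqrt (wmean (\<lambda>_. 1) G' a s)" using D g by simp
    then have "(1 - a) / (2 * a * sqrt (2 * g)) \<le> (1 - t\<^sup>2) / (s * sqrt (wmean (\<lambda>_. 1) G' a s))"
      using D s a t2 g by (intro frac_le mult_mono mult_pos_pos) auto
    then show "(1 - a) / (2 * a * sqrt (2 * g)) \<le> (1 - t\<^sup>2) / ((a + (1 - a) * t\<^sup>2) * sqrt (wmean (\<lambda>_. 1) G' a (a + (1 - a) * t\<^sup>2)))"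
      by (simp add: s_def)
  qed (use a pos in auto)
  moreover have "1 / 32 \<le> sqrt (G a) / 2 * ((1 - a) * sqrt (1 - a)) * I"
  proof -
    have I: "I = (1 - a) / (sqrt a * sqrt (2 * g))"
    proof -
      have "2 * sqrt a / (2 * a) = 1 / sqrt a"
        using a real_sqrt_mult_self[of a] by (simp add: field_simps)
      moreover have "I = (1 - a) / sqrt (2 * g) * (2 * sqrt a / (2 * a))" by (simp add: I_def)
      ultimately show ?thesis by (simp add: mult.commute)
    qed
    \<comment> \<open>This lower bound for \<open>sqrt (G a)\<close> cancels the denominator of
      \<open>I\<close>, leaving a bound that depends only on \<open>1 - a\<close>.\<close>
    have "sqrt a * sqrt (2 * g) / 2 = sqrt (a * (g / 2))"
      using real_sqrt_divide[of "a * (2 * g)" 4] by (simp add: real_sqrt_mult)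
    also have "\<dots> \<le> sqrt (G a)" using Ga by simp
    finally have 1: "sqrt a * sqrt (2 * g) / 2 / 2 \<le> sqrt (G a) / 2" by simp
    have "1 - a \<le> sqrt (1 - a)" using a by (intro real_le_rsqrt) (simp add: power2_eq_square mult_left_le)
    then have 2: "3 / 4 \<le> sqrt (1 - a)" using a by linarith
    have "1 / 32 \<le> (1 / 4) * ((3 / 4) * (3 / 4)) * (3 / 4 :: real)" by simp
    also have "\<dots> \<le> (1 / 4) * ((1 - a) * sqrt (1 - a)) * (1 - a)"
      using a 2 by (intro mult_mono) auto
    also have "\<dots> = sqrt a * sqrt (2 * g) / 2 / 2 * ((1 - a) * sqrt (1 - a)) * I"
      unfolding I using a g by simp
    also have "\<dots> \<le> sqrt (G a) / 2 * ((1 - a) * sqrt (1 - a)) * I"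
      by (intro mult_right_mono 1) (use a g in \<open>auto simp: I_def\<close>)
    finally show ?thesis .
  qed
  ultimately show thesis using that[of a] a by simp
qed

text \<open>At a critical point \<open>z\<close> of \<open>G\<close> the profile becomes a front connecting \<open>z\<close> to 1, and the
  momentum diverges like \<open>\<integral>dt / (\<epsilon> + t)\<close> with \<open>a = z + \<epsilon>\<^sup>2\<close>.\<close>
lemma soliton_momentum_near_front:
  assumes G': "\<And>x. (G' has_real_derivative G'' x) (at x)" and G'': "continuous_on UNIV G''"
    and z: "0 < z" "z < 1" "G' z \<le> 0" and pos: "\<And>s. z < s \<Longrightarrow> s \<le> 1 \<Longrightarrow> G' s > 0"
    and m: "m > 0" "\<And>s. z \<le> s \<Longrightarrow> s \<le> 1 \<Longrightarrow> m \<le> G s"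
  obtains a where "z < a" "a < 1" "B \<le> soliton_momentum G G' a"
proof -
  have cG': "continuous_on UNIV G'"
    using G' by (meson DERIV_continuous continuous_at_imp_continuous_on)
  have ne: "{z..1} \<noteq> {}" using z by simp
  obtain y where y: "\<forall>s\<in>{z..1}. G'' s \<le> G'' y"
    using continuous_attains_sup[OF compact_Icc ne continuous_on_subset[OF G'']] by blast
  \<comment> \<open>A bound for \<open>G''\<close> on [\<open>z\<close>, 1], made positive by the
    summand 1.\<close>
  define K where "K = \<bar>G'' y\<bar> + 1"
  have K: "K > 0" by (simp add: K_def)
  have lin: "G' s \<le> K * (s - z)" if "z \<le> s" "s \<le> 1" for s
  proof (cases "s = z")
    case False
    then have "z < s" using that by simp
    then obtain x where x: "z < x" "x < s" "G' s - G' z = (s - z) * G'' x"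
      using MVT2[of z s G' G''] G' by blast
    have "G'' x \<le> K" using bspec[OF y, of x] x that by (simp add: K_def)
    then have "(s - z) * G'' x \<le> (s - z) * K" using that by (intro mult_left_mono) auto
    then have "G' s - G' z \<le> K * (s - z)" using x(3) by (simp only: mult.commute)
    then show ?thesis using z(3) by simp
  qed (use z in simp)
  \<comment> \<open>With \<open>\<epsilon>\<^sup>2 \<le> d\<close> the point \<open>a\<close> stays
    at distance at least \<open>d\<close> from 1.\<close>
  define d where "d = (1 - z) / 2"
  have d: "0 < d" "d \<le> 1 / 2" using z by (simp_all add: d_def)
  \<comment> \<open>On [0, 1/2] the numerator is at least 3/4, the density at most 1 and the root at
    most \<open>sqrt K * (\<epsilon> + t)\<close>, whence the minorant
    \<open>C / (\<epsilon> + t)\<close>.\<close>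
  define C where "C = 3 / (4 * sqrt K)"
  define N where "N = sqrt m / 2 * (d * sqrt d) * C"
  have C: "C > 0" and N: "N > 0" using K m d by (simp_all add: C_def N_def)
  \<comment> \<open>The second entry makes \<open>ln (1 / (2 * \<epsilon>))\<close>, a lower bound
    for the logarithm in \<open>I\<close>, at least \<open>B / N\<close>.\<close>
  define \<epsilon> where "\<epsilon> = min d (exp (- B / N) / 2)"
  have \<epsilon>: "0 < \<epsilon>" "\<epsilon> \<le> d" "\<epsilon> \<le> exp (- B / N) / 2" using d by (auto simp: \<epsilon>_def)
  have "\<epsilon> * \<epsilon> \<le> d * 1" using \<epsilon> d by (intro mult_mono) auto
  then have \<epsilon>2: "\<epsilon>\<^sup>2 \<le> d" by (simp add: power2_eq_square)
  define a where "a = z + \<epsilon>\<^sup>2"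
  have "\<epsilon>\<^sup>2 > 0" using \<epsilon> by simp
  then have a: "z < a" "a < 1" "d \<le> 1 - a" using \<epsilon>2 d by (auto simp: a_def d_def)
  have mGa: "m \<le> G a" using m(2) a by simp
  define I where "I = C * ln ((\<epsilon> + 1 / 2) / \<epsilon>)"
  have I0: "0 \<le> I" using C \<epsilon> by (simp add: I_def)
  have "sqrt (G a) / 2 * ((1 - a) * sqrt (1 - a)) * I \<le> soliton_momentum G G' a"
  proof (rule soliton_momentum_ge[OF cG', where l = 0 and h = "1 / 2"])
    show "0 \<le> G a" using m(1) mGa by simp
    have "((\<lambda>t. C * (1 / (\<epsilon> + t))) has_integral C * ln (\<epsilon> + 1 / 2) - C * ln (\<epsilon> + 0)) {0..1 / 2}"
    proof (rule fundamental_theorem_of_calculus)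
      fix t :: real assume "t \<in> {0..1 / 2}"
      then have "((\<lambda>t. C * ln (\<epsilon> + t)) has_real_derivative C * (1 / (\<epsilon> + t))) (at t within {0..1 / 2})"
        using \<epsilon> by (auto intro!: derivative_eq_intros)
      then show "((\<lambda>t. C * ln (\<epsilon> + t)) has_vector_derivative C * (1 / (\<epsilon> + t))) (at t within {0..1 / 2})"
        by (simp add: has_real_derivative_iff_has_vector_derivative)
    qed simp
    moreover have "C * ln (\<epsilon> + 1 / 2) - C * ln (\<epsilon> + 0) = I"
      using \<epsilon> by (simp add: I_def ln_div right_diff_distrib)
    ultimately show "((\<lambda>t. C * (1 / (\<epsilon> + t))) has_integral I) {0..1 / 2}" by simp
    fix t :: real assume t: "t \<in> {0..1 / 2}"
    define s where "s = a + (1 - a) * t\<^sup>2"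
    have t1: "t \<in> {-1..1}" using t by auto
    have s: "a \<le> s" "s \<le> 1" using profile_bounds[of a t] a z t1 by (auto simp: s_def)
    have "t * t \<le> (1 / 2) * (1 / 2)" using t by (intro mult_mono) auto
    then have t2: "t\<^sup>2 \<le> 1 / 4" by (simp add: power2_eq_square)
    have D0: "wmean (\<lambda>_. 1) G' a s > 0"
      by (rule wmean_one_pos[OF cG']) (use pos a s in auto)
    have "(1 - a) * t\<^sup>2 \<le> 1 * t\<^sup>2" using a z by (intro mult_right_mono) auto
    then have "s - z \<le> \<epsilon>\<^sup>2 + t\<^sup>2" by (simp add: s_def a_def)
    also have "\<dots> \<le> (\<epsilon> + t)\<^sup>2" using \<epsilon> t by (simp add: power2_sum)
    finally have sz: "K * (s - z) \<le> K * (\<epsilon> + t)\<^sup>2" using K by simp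
    have "wmean (\<lambda>_. 1) G' a s \<le> K * (s - z)"
    proof (rule wmean_one_bounds(2)[OF cG', where m = 0])
      fix x assume x: "a \<le> x" "x \<le> s"
      have "K * (x - z) \<le> K * (s - z)" using K x by simp
      then show "0 \<le> G' x \<and> G' x \<le> K * (s - z)" using lin[of x] pos[of x] x a s by simp
    qed (rule s)
    then have "sqrt (wmean (\<lambda>_. 1) G' a s) \<le> sqrt (K * (\<epsilon> + t)\<^sup>2)" using sz by simp
    also have "\<dots> = sqrt K * (\<epsilon> + t)" using \<epsilon> t by (simp add: real_sqrt_mult)
    finally have D: "sqrt (wmean (\<lambda>_. 1) G' a s) \<le> sqrt K * (\<epsilon> + t)" .
    have "C * (1 / (\<epsilon> + t)) = (3 / 4) / (1 * (sqrt K * (\<epsilon> + t)))" by (simp add: C_def)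
    also have "\<dots> \<le> (1 - t\<^sup>2) / (s * sqrt (wmean (\<lambda>_. 1) G' a s))"
      using t2 D D0 s a z by (intro frac_le mult_mono mult_pos_pos) auto
    finally show "C * (1 / (\<epsilon> + t)) \<le> (1 - t\<^sup>2) / ((a + (1 - a) * t\<^sup>2) * sqrt (wmean (\<lambda>_. 1) G' a (a + (1 - a) * t\<^sup>2)))"
      by (simp add: s_def)
  qed (use a z pos in auto)
  moreover have "B \<le> sqrt (G a) / 2 * ((1 - a) * sqrt (1 - a)) * I"
  proof -
    have "ln (2 * \<epsilon>) \<le> ln (exp (- B / N))" using \<epsilon> by (intro ln_mono) auto
    moreover have "ln (1 / (2 * \<epsilon>)) \<le> ln ((\<epsilon> + 1 / 2) / \<epsilon>)"
      using \<epsilon> by (intro ln_mono) (auto simp: field_simps)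
    ultimately have "B / N \<le> ln ((\<epsilon> + 1 / 2) / \<epsilon>)"
      using \<epsilon>(1) by (simp add: ln_div)
    then have "N * (B / N) \<le> N * ln ((\<epsilon> + 1 / 2) / \<epsilon>)" using N by (intro mult_left_mono) auto
    moreover have "N * (B / N) = B" using N by simp
    ultimately have "B \<le> sqrt m / 2 * (d * sqrt d) * I" by (simp add: I_def N_def mult_ac)
    also have "\<dots> \<le> sqrt (G a) / 2 * ((1 - a) * sqrt (1 - a)) * I"
      using a d m(1) mGa I0 by (intro mult_right_mono mult_mono divide_right_mono) auto
    finally show ?thesis .
  qed
  ultimately show thesis using that[of a] a by simp
qed

lemma large_momentum_branch:
  assumes G: "\<And>x. (G has_real_derivative G' x) (at x)" and G0: "G 0 = 0"
    and G': "\<And>x. (G' has_real_derivative G'' x) (at x)" and G'': "continuous_on UNIV G''"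
    and G'0: "G' 0 > 0" and G'1: "G' 1 > 0" and \<kappa>: "\<kappa> > 0" "\<And>s. 0 \<le> s \<Longrightarrow> \<kappa> * s \<le> G s"
  obtains a where "0 < a" "a < 1" "\<And>s. a \<le> s \<Longrightarrow> s \<le> 1 \<Longrightarrow> G' s > 0" "1 / 32 \<le> soliton_momentum G G' a"
proof -
  have cG': "continuous_on S G'" for S
    using G' by (meson DERIV_continuous continuous_at_imp_continuous_on)
  define Z where "Z = {s \<in> {0..1}. G' s \<le> 0}"
  show thesis
  proof (cases "Z = {}")
    case True
    then have pos: "G' s > 0" if "0 \<le> s" "s \<le> 1" for s using that by (force simp: Z_def)
    obtain a where "0 < a" "a < 1" "1 / 32 \<le> soliton_momentum G G' a"
      using soliton_momentum_near_black[OF G G0 cG' pos] by blast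
    then show thesis using that[of a] pos by simp
  next
    case False
    have "closed Z"
    proof -
      have "Z = {0..1} \<inter> G' -` {..0}" by (auto simp: Z_def)
      then show ?thesis using continuous_closed_preimage[OF cG' closed_atLeastAtMost closed_atMost] by simp
    qed
    moreover have "bounded Z" by (rule bounded_subset[OF bounded_closed_interval[of 0 1]]) (auto simp: Z_def)
    ultimately have "compact Z" by (simp add: compact_eq_bounded_closed)
    then obtain z where z: "z \<in> Z" "\<And>s. s \<in> Z \<Longrightarrow> s \<le> z"
      using compact_attains_sup[OF _ False] by blast
    have "z \<noteq> 0" "z \<noteq> 1" using z(1) G'0 G'1 by (auto simp: Z_def)
    then have z': "0 < z" "z < 1" "G' z \<le> 0" using z(1) by (auto simp: Z_def)
    have pos: "G' s > 0" if "z < s" "s \<le> 1" for s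
      using z(2)[of s] that z' by (force simp: Z_def)
    \<comment> \<open>This keeps the speeds \<open>sqrt (G a)\<close> away from 0 as
      \<open>a\<close> decreases to \<open>z\<close>, so that they cannot offset the divergence of
      the integral.\<close>
    have m: "\<kappa> * z \<le> G s" if "z \<le> s" "s \<le> 1" for s
      using \<kappa>(2)[of s] that z' mult_left_mono[of z s \<kappa>] \<kappa>(1) by linarith
    obtain a where "z < a" "a < 1" "1 / 32 \<le> soliton_momentum G G' a"
      by (rule soliton_momentum_near_front[OF G' G'' z' pos _ m, where B = "1 / 32"]) (use \<kappa>(1) z' in auto)
    then show thesis using that[of a] z' pos by simp
  qed
qed

section \<open>Existence of travelling waves of prescribed momentum\<close>

theorem theorem1p6:
  fixes f :: "real \<Rightarrow> real" and F :: "real \<Rightarrow> real" and c\<^sub>s :: real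
  assumes smooth: "C_k 3 f"
    and f1: "f 1 = 0"
    and df1: "deriv f 1 < 0"
    and F_def: "F = potential f"
    and cs_def: "c\<^sub>s = sqrt (- 2 * deriv f 1)"
    and H1: "\<And>\<rho>. \<rho> \<ge> 0 \<Longrightarrow> c\<^sub>s\<^sup>2 / 4 * (1 - \<rho>)\<^sup>2 \<le> F \<rho>"
    and H2: "\<exists>M \<ge> 0. \<exists>q \<ge> 2. \<forall>\<rho> \<ge> 2. F \<rho> \<le> M * \<bar>1 - \<rho>\<bar> powr q"
    and H3: "(deriv ^^ 2) f 1 + 3 * deriv f 1 \<noteq> 0"
  shows "\<exists>q0 \<ge> 1 / 32. \<forall>p::real.
           (0 < p \<and> p < q0) \<or> (p = q0 \<and> (\<forall>k::int. q0 \<noteq> pi / 2 + pi * of_int k)) \<longrightarrow>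
           (\<exists>c v. 0 < c \<and> c < c\<^sub>s \<and> travelling_wave f c v \<and> has_momentum v p)"
proof -
  have D: "((deriv ^^ j) f has_real_derivative (deriv ^^ Suc j) f x) (at x)" if "j < 3" for j x
    using smooth that unfolding C_k_def by (auto simp: DERIV_deriv_iff_real_differentiable)
  define f' f'' f''' where "f' = (deriv ^^ 1) f" and "f'' = (deriv ^^ 2) f" and "f''' = (deriv ^^ 3) f"
  have df: "(f has_real_derivative f' x) (at x)" for x using D[of 0 x] by (simp add: f'_def)
  have df': "(f' has_real_derivative f'' x) (at x)" for x
    using D[of 1 x] by (simp add: f'_def f''_def numeral_2_eq_2)
  have df'': "(f'' has_real_derivative f''' x) (at x)" for x
    using D[of 2 x] by (simp add: f''_def f'''_def numeral_3_eq_3 numeral_2_eq_2)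
  have cf''': "continuous_on UNIV f'''" using smooth by (simp add: C_k_def f'''_def)
  have cont: "continuous_on UNIV f" "continuous_on UNIV f'" "continuous_on UNIV f''"
    using df df' df'' by (meson DERIV_continuous continuous_at_imp_continuous_on)+
  have dF: "(F has_real_derivative - f x) (at x)" for x
    unfolding F_def by (rule potential_has_real_derivative) (rule cont)
  \<comment> \<open>By Taylor's formula this is 4 F(s) / (1 - s)^2 with the double zero at 1 divided
    out; it is C^2 because \<open>f'\<close> is.\<close>
  define h where "h s = 4 * wmean (\<lambda>\<theta>. 1 - \<theta>) (\<lambda>x. - f' x) 1 s" for s
  define h' where "h' s = 4 * wmean (\<lambda>\<theta>. (1 - \<theta>) * \<theta>) (\<lambda>x. - f'' x) 1 s" for s
  define h'' where "h'' s = 4 * wmean (\<lambda>\<theta>. (1 - \<theta>) * \<theta> * \<theta>) (\<lambda>x. - f''' x) 1 s" for s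
  have dh: "(h has_real_derivative h' s) (at s)" for s
    unfolding h_def[abs_def] h'_def
    by (intro DERIV_cmult has_real_derivative_wmean continuous_intros DERIV_minus df' cont)
  have dh': "(h' has_real_derivative h'' s) (at s)" for s
    unfolding h'_def[abs_def] h''_def
    by (intro DERIV_cmult has_real_derivative_wmean continuous_intros DERIV_minus df'' cf''')
  have ch'': "continuous_on UNIV h''"
    unfolding h''_def[abs_def] by (intro continuous_intros continuous_on_wmean2 cf''')
  have ch': "continuous_on UNIV h'"
    using dh' by (meson DERIV_continuous continuous_at_imp_continuous_on)
  have Fh: "4 * F s = (1 - s)\<^sup>2 * h s" for s
    unfolding F_def h_def using potential_Taylor[OF df cont(2) f1, of s] by simp
  have cs2: "c\<^sub>s\<^sup>2 = - 2 * f' 1" using df1 by (simp add: cs_def f'_def)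
  have cs_pos: "c\<^sub>s > 0" using df1 by (simp add: cs_def)
  \<comment> \<open>The weight \<open>1 - \<theta>\<close> has integral 1/2 over [0, 1].\<close>
  have h1: "h 1 = c\<^sub>s\<^sup>2"
  proof -
    have "((\<lambda>\<theta>::real. 1 - \<theta>) has_integral (1 - 1\<^sup>2 / 2) - (0 - 0\<^sup>2 / 2)) {0..1}"
      by (rule fundamental_theorem_of_calculus)
         (auto simp flip: has_real_derivative_iff_has_vector_derivative intro!: derivative_eq_intros)
    then have "integral {0..1} (\<lambda>\<theta>::real. 1 - \<theta>) = 1 / 2" by (simp add: integral_unique)
    then show ?thesis by (simp add: h_def wmean_def cs2 del: integral_diff)
  qed
  have h_ge: "c\<^sub>s\<^sup>2 \<le> h s" if "0 \<le> s" for s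
  proof (cases "s = 1")
    case False
    have "(1 - s)\<^sup>2 * c\<^sub>s\<^sup>2 \<le> (1 - s)\<^sup>2 * h s"
      using H1[OF that] Fh[of s] by (simp add: mult.commute)
    then show ?thesis using False by simp
  qed (simp add: h1)
  \<comment> \<open>By \<open>h_ge\<close> the point 1 minimises \<open>h\<close> among nonnegative
    arguments, which include its neighbourhood of radius 1.\<close>
  have h'1: "h' 1 = 0"
    by (rule DERIV_local_min[OF dh, of 1]) (auto simp: h1 intro!: h_ge)
  define G where "G s = s * h s" for s
  define G' where "G' s = h s + s * h' s" for s
  define G'' where "G'' s = 2 * h' s + s * h'' s" for s
  have dG: "(G has_real_derivative G' s) (at s)" for s
    unfolding G_def[abs_def] G'_def by (rule derivative_eq_intros dh refl | simp)+
  have dG': "(G' has_real_derivative G'' s) (at s)" for s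
    unfolding G'_def[abs_def] G''_def by (rule derivative_eq_intros dh dh' refl | simp)+
  have cG'': "continuous_on UNIV G''"
    unfolding G''_def[abs_def] by (intro continuous_intros ch' ch'')
  have cG: "continuous_on UNIV G" "continuous_on UNIV G'"
    using dG dG' by (meson DERIV_continuous continuous_at_imp_continuous_on)+
  have G_ge: "c\<^sub>s\<^sup>2 * s \<le> G s" if "0 \<le> s" for s
    using mult_right_mono[OF h_ge[OF that] that] by (simp add: G_def mult.commute)
  have G'0: "G' 0 > 0" and G'1: "G' 1 > 0" and G1: "G 1 = c\<^sub>s\<^sup>2"
    using h_ge[of 0] h'1 h1 cs_pos by (auto simp: G'_def G_def intro: less_le_trans[of 0 "c\<^sub>s\<^sup>2"])
  have "0 < c\<^sub>s\<^sup>2" and "G 0 = 0" using cs_pos by (simp_all add: G_def)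
  then obtain a0 where a0: "0 < a0" "a0 < 1" "\<And>s. a0 \<le> s \<Longrightarrow> s \<le> 1 \<Longrightarrow> G' s > 0"
      "1 / 32 \<le> soliton_momentum G G' a0"
    using large_momentum_branch[OF dG _ dG' cG'' G'0 G'1 _ G_ge] by blast
  have wave: "\<exists>c v. 0 < c \<and> c < c\<^sub>s \<and> travelling_wave f c v \<and> has_momentum v p" if p: "0 < p" "p \<le> 1 / 32" for p
  proof -
    \<comment> \<open>The momentum is at least 1/32 at \<open>a0\<close> and equals 0 at 1, so every
      intermediate value is attained; \<open>p > 0\<close> then excludes
      \<open>a = 1\<close>.\<close>
    have "\<exists>a\<ge>a0. a \<le> 1 \<and> soliton_momentum G G' a = p"
    proof (rule IVT2')
      show "soliton_momentum G G' 1 \<le> p" using p by (simp add: soliton_momentum_def)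
      show "continuous_on {a0..1} (soliton_momentum G G')"
        by (rule continuous_on_soliton_momentum[OF cG a0(1,3)])
    qed (use p a0 in auto)
    then obtain a where ap: "a0 \<le> a" "a \<le> 1" "soliton_momentum G G' a = p" by blast
    have "a \<noteq> 1" using ap(3) p by (auto simp: soliton_momentum_def)
    then have a': "0 < a" "a < 1" using ap a0 by auto
    have pos: "G' s > 0" if "a \<le> s" "s \<le> 1" for s using a0(3) that ap by simp
    have "0 < c\<^sub>s\<^sup>2 * a" using cs_pos a' by simp
    then have Ga: "0 < G a" using G_ge[of a] a' by linarith
    have FG: "4 * s * F s = (1 - s)\<^sup>2 * G s" for s
    proof -
      have "4 * s * F s = s * (4 * F s)" by simp
      then show ?thesis unfolding Fh G_def by simp
    qed
    interpret soliton f F G G' G'' a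
      by unfold_locales (use dF dG dG' cG'' FG a' Ga pos in auto)
    obtain v where v: "travelling_wave f (sqrt (G a)) v" "has_momentum v (soliton_momentum G G' a)"
      using travelling_wave_exists[OF F_def] by blast
    \<comment> \<open>Monotonicity of \<open>G\<close> on [\<open>a\<close>, 1] makes the wave
      strictly subsonic, since \<open>G 1 = c\<^sub>s\<^sup>2\<close>.\<close>
    have "G a < G 1"
      by (rule DERIV_pos_imp_increasing[OF a'(2)]) (use dG pos in blast)
    then have "sqrt (G a) < c\<^sub>s" using cs_pos by (simp add: G1 real_less_lsqrt)
    then show ?thesis using v Ga ap(3) by (intro exI[of _ "sqrt (G a)"] exI[of _ v]) simp
  qed
  \<comment> \<open>The fact \<open>wave\<close> includes the endpoint 1/32, so it covers both
    alternatives for \<open>p\<close>.\<close>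
  show ?thesis by (rule exI[of _ "1 / 32"]) (use wave in auto)
qed

end
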